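(* Let $\mathcal{C}$ be a semi-abelian action representative category, let $h\colon H\rightarrowtail G$ be a characteristic subobject in $\mathcal{C}$, and let $q\colon G\to G/H$ be the cokernel of $h$. Then: (i) $h$ induces a morphism between split extension classifiers: there exist morphisms $\widetilde{q}\colon \mathrm{Act}(G)\to\mathrm{Act}(G/H)$ and $G\rtimes\mathrm{Act}(G)\to (G/H)\rtimes\mathrm{Act}(G/H)$ which, together with $q\colon G\to G/H$ on kernels, form a morphism (commuting with kernel inclusions, projections and sections) from the split extension classifier of $G$ to the split extension classifier of $G/H$; (ii) $h$ induces a morphism between actors: there exists a morphism $\overline{h}\colon \mathrm{Act}(G)\to\mathrm{Act}(H)$ such that $\zeta_H\,(\overline{h}\flat 1_H)=\overline{\zeta_G}\colon \mathrm{Act}(G)\flat H\to H$, where $\zeta_G$ and $\zeta_H$ are the canonical actions of the actors $\mathrm{Act}(G)$ on $G$ and $\mathrm{Act}(H)$ on $H$, and $\overline{\zeta_G}$ is the restriction of the action $\zeta_G$ to the characteristic subobject $H$.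
   Context: For an object $B$ of a pointed category $\mathcal{C}$ with finite limits and finite coproducts, let $\mathrm{Pt}_B(\mathcal{C})$ be the category of points over $B$: objects are split epimorphisms $(A,p,s)$ with $p\colon A\to B$, $s\colon B\to A$, $ps=1_B$; morphisms $(A,p,s)\to(A',p',s')$ are arrows $f\colon A\to A'$ with $p'f=p$, $fs=s'$. The functor $\mathrm{Ker}_B\colon \mathrm{Pt}_B(\mathcal{C})\to\mathcal{C}$, $(A,p,s)\mapsto \mathrm{Ker}(p)$, is right adjoint to $B+(-)$, which sends $X$ to the point $(B+X,[1,0],\iota_B)$. The induced monad on $\mathcal{C}$ is denoted $B\flat(-)$, so that $B\flat X$ is the kernel of $[1,0]\colon B+X\to B$; it is functorial in both variables. An (internal) action of $B$ on $X$ is an algebra $\xi\colon B\flat X\to X$ for this monad. A point $(A,p,s)$ over $B$ with kernel $k\colon X\to A$ determines the action $\xi$ of $B$ on $X$ with $k\xi=[s,k]\ker[1,0]$; in a semi-abelian category this gives an equivalence between points over $B$ (equivalently, split extensions with cokernel $B$) and actions of $B$. A subobject $h\colon H\rightarrowtail G$ is called characteristic in $G$ if for every object $B$ and every action $\xi\colon B\flat G\to G$ there exists a (unique) action $\overline{\xi}\colon B\flat H\to H$ with $h\,\overline{\xi}=\xi\,(1_B\flat h)$. Characteristic subobjects in a semi-abelian category are normal, so $G/H$ makes sense. A split extension with kernel $X$ is a diagram $X\xrightarrow{k}A\rightleftarrows B$ with $p\colon A\to B$, $s\colon B\to A$, $ps=1_B$ and $k=\ker p$. A semi-abelian category is action representative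 if for every object $X$ there exist an object $\mathrm{Act}(X)$ (the actor of $X$) and a split extension $X\to X\rtimes\mathrm{Act}(X)\rightleftarrows\mathrm{Act}(X)$ (the split extension classifier of $X$) such that for every split extension $X\to A\rightleftarrows B$ with kernel $X$ there is a unique morphism $\varphi\colon B\to\mathrm{Act}(X)$ for which there exists a (necessarily unique) $\varphi_1\colon A\to X\rtimes\mathrm{Act}(X)$ making $(1_X,\varphi_1,\varphi)$ a morphism of split extensions. The canonical action $\zeta_X\colon\mathrm{Act}(X)\flat X\to X$ is the action corresponding to the split extension classifier of $X$. *)

theory Defs
  imports Main
begin

section \<open>Categories\<close>

record ('o, 'm) cat =
  Obj :: "'o set"
  Arr :: "'m set"
  Dom :: "'m \<Rightarrow> 'o"
  Cod :: "'m \<Rightarrow> 'o"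
  Ide :: "'o \<Rightarrow> 'm"
  Comp :: "'m \<Rightarrow> 'm \<Rightarrow> 'm" (infixr "\<cdot>\<index>" 75)

definition Hom :: "('o, 'm) cat \<Rightarrow> 'o \<Rightarrow> 'o \<Rightarrow> 'm set" where
  "Hom C A B = {f \<in> Arr C. Dom C f = A \<and> Cod C f = B}"

locale category =
  fixes C :: "('o, 'm) cat" (structure)
  assumes Dom_in_Obj: "f \<in> Arr C \<Longrightarrow> Dom C f \<in> Obj C"
    and Cod_in_Obj: "f \<in> Arr C \<Longrightarrow> Cod C f \<in> Obj C"
    and Ide_in_Hom: "A \<in> Obj C \<Longrightarrow> Ide C A \<in> Hom C A A"
    and Comp_in_Hom: "f \<in> Hom C A B \<Longrightarrow> g \<in> Hom C B D \<Longrightarrow> g \<cdot> f \<in> Hom C A D"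
    and Comp_Ide_left: "f \<in> Hom C A B \<Longrightarrow> Ide C B \<cdot> f = f"
    and Comp_Ide_right: "f \<in> Hom C A B \<Longrightarrow> f \<cdot> Ide C A = f"
    and Comp_assoc: "f \<in> Hom C A B \<Longrightarrow> g \<in> Hom C B D \<Longrightarrow> h \<in> Hom C D E \<Longrightarrow>
      (h \<cdot> g) \<cdot> f = h \<cdot> (g \<cdot> f)"

text \<open>
  Everything below is stated for an arbitrary \<open>C\<close>; it is meaningful only when \<open>C\<close> is a category.
  Universal constructions are given by their structural arrows, the apex being the domain or
  codomain of these.
\<close>

context
  fixes C :: "('o, 'm) cat" (structure)
begin

definition is_mono :: "'m \<Rightarrow> bool" where
  "is_mono f \<longleftrightarrow> f \<in> Arr C \<and>
    (\<forall>X g g'. g \<in> Hom C X (Dom C f) \<and> g' \<in> Hom C X (Dom C f) \<and> f \<cdot> g = f \<cdot> g' \<longrightarrow> g = g')"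

definition is_iso :: "'m \<Rightarrow> bool" where
  "is_iso f \<longleftrightarrow> f \<in> Arr C \<and>
    (\<exists>g \<in> Hom C (Cod C f) (Dom C f). g \<cdot> f = Ide C (Dom C f) \<and> f \<cdot> g = Ide C (Cod C f))"

definition is_terminal :: "'o \<Rightarrow> bool" where
  "is_terminal T \<longleftrightarrow> T \<in> Obj C \<and> (\<forall>A \<in> Obj C. \<exists>!f. f \<in> Hom C A T)"

definition is_initial :: "'o \<Rightarrow> bool" where
  "is_initial I \<longleftrightarrow> I \<in> Obj C \<and> (\<forall>A \<in> Obj C. \<exists>!f. f \<in> Hom C I A)"

definition is_zero_object :: "'o \<Rightarrow> bool" where
  "is_zero_object Z \<longleftrightarrow> is_initial Z \<and> is_terminal Z"

text \<open>\<open>a\<close> and \<open>b\<close> are the projections of a pullback of the cospan \<open>(f, g)\<close>; \<open>a\<close> is parallel to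
  \<open>g\<close> and \<open>b\<close> to \<open>f\<close>.\<close>

definition is_pullback :: "'m \<Rightarrow> 'm \<Rightarrow> 'm \<Rightarrow> 'm \<Rightarrow> bool" where
  "is_pullback f g a b \<longleftrightarrow>
    f \<in> Arr C \<and> g \<in> Arr C \<and> Cod C f = Cod C g \<and>
    a \<in> Hom C (Dom C a) (Dom C f) \<and> b \<in> Hom C (Dom C a) (Dom C g) \<and> f \<cdot> a = g \<cdot> b \<and>
    (\<forall>X x y. x \<in> Hom C X (Dom C f) \<and> y \<in> Hom C X (Dom C g) \<and> f \<cdot> x = g \<cdot> y \<longrightarrow>
      (\<exists>!u. u \<in> Hom C X (Dom C a) \<and> a \<cdot> u = x \<and> b \<cdot> u = y))"

definition is_coproduct :: "'o \<Rightarrow> 'o \<Rightarrow> 'm \<Rightarrow> 'm \<Rightarrow> bool" where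
  "is_coproduct A B i j \<longleftrightarrow>
    i \<in> Hom C A (Cod C i) \<and> j \<in> Hom C B (Cod C i) \<and>
    (\<forall>X f g. f \<in> Hom C A X \<and> g \<in> Hom C B X \<longrightarrow>
      (\<exists>!u. u \<in> Hom C (Cod C i) X \<and> u \<cdot> i = f \<and> u \<cdot> j = g))"

definition is_coequalizer :: "'m \<Rightarrow> 'm \<Rightarrow> 'm \<Rightarrow> bool" where
  "is_coequalizer f g e \<longleftrightarrow>
    f \<in> Arr C \<and> g \<in> Hom C (Dom C f) (Cod C f) \<and> e \<in> Hom C (Cod C f) (Cod C e) \<and> e \<cdot> f = e \<cdot> g \<and>
    (\<forall>X x. x \<in> Hom C (Cod C f) X \<and> x \<cdot> f = x \<cdot> g \<longrightarrow>
      (\<exists>!u. u \<in> Hom C (Cod C e) X \<and> u \<cdot> e = x))"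

definition is_regular_epi :: "'m \<Rightarrow> bool" where
  "is_regular_epi e \<longleftrightarrow> (\<exists>f g. is_coequalizer f g e)"

definition zero_map :: "'o \<Rightarrow> 'o \<Rightarrow> 'm" where
  "zero_map A B = (THE f. \<exists>Z t i. is_zero_object Z \<and> t \<in> Hom C A Z \<and> i \<in> Hom C Z B \<and> f = i \<cdot> t)"

definition is_kernel :: "'m \<Rightarrow> 'm \<Rightarrow> bool" where
  "is_kernel p k \<longleftrightarrow>
    p \<in> Arr C \<and> k \<in> Hom C (Dom C k) (Dom C p) \<and> p \<cdot> k = zero_map (Dom C k) (Cod C p) \<and>
    (\<forall>X x. x \<in> Hom C X (Dom C p) \<and> p \<cdot> x = zero_map X (Cod C p) \<longrightarrow>
      (\<exists>!u. u \<in> Hom C X (Dom C k) \<and> k \<cdot> u = x))"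

definition is_cokernel :: "'m \<Rightarrow> 'm \<Rightarrow> bool" where
  "is_cokernel h q \<longleftrightarrow>
    h \<in> Arr C \<and> q \<in> Hom C (Cod C h) (Cod C q) \<and> q \<cdot> h = zero_map (Dom C h) (Cod C q) \<and>
    (\<forall>X x. x \<in> Hom C (Cod C h) X \<and> x \<cdot> h = zero_map (Dom C h) X \<longrightarrow>
      (\<exists>!u. u \<in> Hom C (Cod C q) X \<and> u \<cdot> q = x))"


section \<open>Semi-abelian categories\<close>

definition finitely_complete :: bool where
  "finitely_complete \<longleftrightarrow> (\<exists>T. is_terminal T) \<and>
    (\<forall>f g. f \<in> Arr C \<and> g \<in> Arr C \<and> Cod C f = Cod C g \<longrightarrow> (\<exists>a b. is_pullback f g a b))"

definition has_finite_coproducts :: bool where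
  "has_finite_coproducts \<longleftrightarrow> (\<exists>I. is_initial I) \<and>
    (\<forall>A \<in> Obj C. \<forall>B \<in> Obj C. \<exists>i j. is_coproduct A B i j)"

definition pointed :: bool where
  "pointed \<longleftrightarrow> (\<exists>Z. is_zero_object Z)"

definition regular_category :: bool where
  "regular_category \<longleftrightarrow> finitely_complete \<and>
    (\<forall>f a b. is_pullback f f a b \<longrightarrow> (\<exists>e. is_coequalizer a b e)) \<and>
    (\<forall>f g a b. is_pullback f g a b \<and> is_regular_epi f \<longrightarrow> is_regular_epi b)"

text \<open>An internal equivalence relation \<open>r1, r2 : R \<rightarrow> A\<close>. Transitivity is the existence of
  a factorisation through \<open>R\<close> of the object of composable pairs, the pullback of \<open>r2\<close> along
  \<open>r1\<close>.\<close>

definition is_equivalence_relation :: "'m \<Rightarrow> 'm \<Rightarrow> bool" where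
  "is_equivalence_relation r1 r2 \<longleftrightarrow>
    r1 \<in> Arr C \<and> r2 \<in> Hom C (Dom C r1) (Cod C r1) \<and>
    (\<forall>X x y. x \<in> Hom C X (Dom C r1) \<and> y \<in> Hom C X (Dom C r1) \<and>
      r1 \<cdot> x = r1 \<cdot> y \<and> r2 \<cdot> x = r2 \<cdot> y \<longrightarrow> x = y) \<and>
    (\<exists>d \<in> Hom C (Cod C r1) (Dom C r1). r1 \<cdot> d = Ide C (Cod C r1) \<and> r2 \<cdot> d = Ide C (Cod C r1)) \<and>
    (\<exists>c \<in> Hom C (Dom C r1) (Dom C r1). r1 \<cdot> c = r2 \<and> r2 \<cdot> c = r1) \<and>
    (\<forall>a b. is_pullback r2 r1 a b \<longrightarrow>
      (\<exists>t \<in> Hom C (Dom C a) (Dom C r1). r1 \<cdot> t = r1 \<cdot> a \<and> r2 \<cdot> t = r2 \<cdot> b))"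

definition exact_category :: bool where
  "exact_category \<longleftrightarrow> regular_category \<and>
    (\<forall>r1 r2. is_equivalence_relation r1 r2 \<longrightarrow> (\<exists>f. is_pullback f f r1 r2))"

definition is_point :: "'o \<Rightarrow> 'm \<Rightarrow> 'm \<Rightarrow> bool" where
  "is_point B p s \<longleftrightarrow> p \<in> Hom C (Dom C p) B \<and> s \<in> Hom C B (Dom C p) \<and> p \<cdot> s = Ide C B"

definition is_point_morphism :: "'m \<Rightarrow> 'm \<Rightarrow> 'm \<Rightarrow> 'm \<Rightarrow> 'm \<Rightarrow> bool" where
  "is_point_morphism p s p' s' f \<longleftrightarrow>
    f \<in> Hom C (Dom C p) (Dom C p') \<and> p' \<cdot> f = p \<and> f \<cdot> s = s'"

text \<open>Bourn protomodularity: for every \<open>v : E \<rightarrow> B\<close> the change-of-base functor from points over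
  \<open>B\<close> to points over \<open>E\<close> reflects isomorphisms. Here \<open>e\<close> and \<open>e'\<close> are the pullbacks of \<open>p\<close> and
  \<open>p'\<close> along \<open>v\<close>, and \<open>u\<close> is the arrow induced by \<open>f\<close>. The induced sections play no role, since
  an arrow of points is invertible as soon as its underlying arrow is.\<close>

definition protomodular :: bool where
  "protomodular \<longleftrightarrow>
    (\<forall>B p s p' s' f v a e a' e' u.
      is_point B p s \<and> is_point B p' s' \<and> is_point_morphism p s p' s' f \<and>
      is_pullback p v a e \<and> is_pullback p' v a' e' \<and>
      u \<in> Hom C (Dom C a) (Dom C a') \<and> a' \<cdot> u = f \<cdot> a \<and> e' \<cdot> u = e \<and> is_iso u
      \<longrightarrow> is_iso f)"

definition semi_abelian :: bool where
  "semi_abelian \<longleftrightarrow> category C \<and> pointed \<and> has_finite_coproducts \<and> exact_category \<and> protomodular"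


section \<open>Internal actions\<close>

text \<open>A fixed choice of binary coproducts and of kernels of the arrows \<open>[1, 0] : B + X \<rightarrow> B\<close>.\<close>

definition coprod_inj :: "'o \<Rightarrow> 'o \<Rightarrow> 'm \<times> 'm" where
  "coprod_inj A B = (SOME (i, j). is_coproduct A B i j)"

definition inl :: "'o \<Rightarrow> 'o \<Rightarrow> 'm" where
  "inl A B = fst (coprod_inj A B)"

definition inr :: "'o \<Rightarrow> 'o \<Rightarrow> 'm" where
  "inr A B = snd (coprod_inj A B)"

definition coprod :: "'o \<Rightarrow> 'o \<Rightarrow> 'o" where
  "coprod A B = Cod C (inl A B)"

definition copair :: "'m \<Rightarrow> 'm \<Rightarrow> 'm" where
  "copair f g = (THE u. u \<in> Hom C (coprod (Dom C f) (Dom C g)) (Cod C f) \<and>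
    u \<cdot> inl (Dom C f) (Dom C g) = f \<and> u \<cdot> inr (Dom C f) (Dom C g) = g)"

definition flat_ker :: "'o \<Rightarrow> 'o \<Rightarrow> 'm" where
  "flat_ker B X = (SOME k. is_kernel (copair (Ide C B) (zero_map X B)) k)"

definition flat :: "'o \<Rightarrow> 'o \<Rightarrow> 'o" where
  "flat B X = Dom C (flat_ker B X)"

text \<open>The arrow \<open>b \<flat> x\<close>, that is, the restriction of \<open>b + x\<close> to the chosen kernels.\<close>

definition flat_map :: "'m \<Rightarrow> 'm \<Rightarrow> 'm" where
  "flat_map b x = (THE u. u \<in> Hom C (flat (Dom C b) (Dom C x)) (flat (Cod C b) (Cod C x)) \<and>
    flat_ker (Cod C b) (Cod C x) \<cdot> u =
      copair (inl (Cod C b) (Cod C x) \<cdot> b) (inr (Cod C b) (Cod C x) \<cdot> x) \<cdot> flat_ker (Dom C b) (Dom C x))"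

text \<open>The adjunction between \<open>B + (-)\<close> and the kernel functor on points over \<open>B\<close> has unit
  \<open>X \<rightarrow> B \<flat> X\<close> given by the second injection, and its counit at a point with section \<open>s\<close> and
  kernel \<open>k\<close> is \<open>[s, k]\<close>. The multiplication of the induced monad is the restriction to kernels of
  the counit at the point \<open>(B + X, [1, 0], inl)\<close>.\<close>

definition flat_unit :: "'o \<Rightarrow> 'o \<Rightarrow> 'm" where
  "flat_unit B X = (THE u. u \<in> Hom C X (flat B X) \<and> flat_ker B X \<cdot> u = inr B X)"

definition flat_mult :: "'o \<Rightarrow> 'o \<Rightarrow> 'm" where
  "flat_mult B X = (THE u. u \<in> Hom C (flat B (flat B X)) (flat B X) \<and>
    flat_ker B X \<cdot> u = copair (inl B X) (flat_ker B X) \<cdot> flat_ker B (flat B X))"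

definition is_action :: "'o \<Rightarrow> 'o \<Rightarrow> 'm \<Rightarrow> bool" where
  "is_action B X \<xi> \<longleftrightarrow> B \<in> Obj C \<and> X \<in> Obj C \<and> \<xi> \<in> Hom C (flat B X) X \<and>
    \<xi> \<cdot> flat_unit B X = Ide C X \<and>
    \<xi> \<cdot> flat_mult B X = \<xi> \<cdot> flat_map (Ide C B) \<xi>"

definition is_restricted_action :: "'m \<Rightarrow> 'o \<Rightarrow> 'm \<Rightarrow> 'm \<Rightarrow> bool" where
  "is_restricted_action h B \<xi> \<xi>' \<longleftrightarrow>
    is_action B (Dom C h) \<xi>' \<and> h \<cdot> \<xi>' = \<xi> \<cdot> flat_map (Ide C B) h"

definition characteristic :: "'m \<Rightarrow> bool" where
  "characteristic h \<longleftrightarrow> is_mono h \<and>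
    (\<forall>B \<in> Obj C. \<forall>\<xi>. is_action B (Cod C h) \<xi> \<longrightarrow> (\<exists>!\<xi>'. is_restricted_action h B \<xi> \<xi>'))"

definition restrict_action :: "'m \<Rightarrow> 'o \<Rightarrow> 'm \<Rightarrow> 'm" where
  "restrict_action h B \<xi> = (THE \<xi>'. is_restricted_action h B \<xi> \<xi>')"


section \<open>Split extensions and actors\<close>

definition is_split_extension :: "'o \<Rightarrow> 'o \<Rightarrow> 'm \<Rightarrow> 'm \<Rightarrow> 'm \<Rightarrow> bool" where
  "is_split_extension X B k p s \<longleftrightarrow> is_point B p s \<and> is_kernel p k \<and> Dom C k = X"

definition is_split_extension_morphism ::
  "'m \<times> 'm \<times> 'm \<Rightarrow> 'm \<times> 'm \<times> 'm \<Rightarrow> 'm \<Rightarrow> 'm \<Rightarrow> 'm \<Rightarrow> bool" where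
  "is_split_extension_morphism = (\<lambda>(k, p, s) (k', p', s') x \<phi>\<^sub>1 \<phi>.
    x \<in> Hom C (Dom C k) (Dom C k') \<and> \<phi>\<^sub>1 \<in> Hom C (Dom C p) (Dom C p') \<and>
    \<phi> \<in> Hom C (Cod C p) (Cod C p') \<and>
    \<phi>\<^sub>1 \<cdot> k = k' \<cdot> x \<and> p' \<cdot> \<phi>\<^sub>1 = \<phi> \<cdot> p \<and> \<phi>\<^sub>1 \<cdot> s = s' \<cdot> \<phi>)"

text \<open>In \<open>is_split_extension_classifier X A k p s\<close> the object \<open>A\<close> is the actor \<open>Act(X)\<close>.\<close>

definition is_split_extension_classifier :: "'o \<Rightarrow> 'o \<Rightarrow> 'm \<Rightarrow> 'm \<Rightarrow> 'm \<Rightarrow> bool" where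
  "is_split_extension_classifier X A k p s \<longleftrightarrow> is_split_extension X A k p s \<and>
    (\<forall>B k' p' s'. is_split_extension X B k' p' s' \<longrightarrow>
      (\<exists>!\<phi>. \<phi> \<in> Hom C B A \<and>
        (\<exists>\<phi>\<^sub>1. is_split_extension_morphism (k', p', s') (k, p, s) (Ide C X) \<phi>\<^sub>1 \<phi>)))"

definition action_representative :: bool where
  "action_representative \<longleftrightarrow>
    (\<forall>X \<in> Obj C. \<exists>A k p s. is_split_extension_classifier X A k p s)"

definition action_of_split_extension :: "'m \<Rightarrow> 'm \<Rightarrow> 'm \<Rightarrow> 'm" where
  "action_of_split_extension k p s = (THE \<xi>. \<xi> \<in> Hom C (flat (Cod C p) (Dom C k)) (Dom C k) \<and>
    k \<cdot> \<xi> = copair s k \<cdot> flat_ker (Cod C p) (Dom C k))"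

end

end

theory Submission
  imports Defs
begin

text \<open>
  A split extension \<open>(A, p, s)\<close> of \<open>B\<close> by \<open>G\<close> restricts to a characteristic \<open>h : H \<rightarrow> G\<close>: the image of
  \<open>[s, k h] : B + H \<rightarrow> A\<close> is a point over \<open>B\<close> with kernel \<open>H\<close>, and it induces the restricted action.
  Applied to the classifier of \<open>G\<close>, this gives the arrow \<open>Act(G) \<rightarrow> Act(H)\<close>.

  Applied to the kernel pair of \<open>p\<close>, viewed as a split extension of \<open>A\<close> by \<open>G\<close>, it gives a reflexive
  relation on \<open>A\<close> contained in the kernel pair of \<open>p\<close>. By protomodularity and exactness it is a
  kernel pair, so \<open>A\<close> can be divided by it, which yields a split extension of \<open>B\<close> by \<open>G/H\<close>. For the
  classifier of \<open>G\<close> this gives the arrow \<open>Act(G) \<rightarrow> Act(G/H)\<close>.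
\<close>

section \<open>Arrows and universal properties\<close>

text \<open>The hypothesis on \<open>h\<close> speaks of actions, whereas both conclusions concern
  split extensions, so a restricted action has to be realized by a point. Instead of building a
  semidirect product from an action, the proof uses that the action on G already comes from a total
  object A, and looks for the total object of the restriction inside A. The point to settle is that
  the subobject found there meets G in H and in nothing more; this is where stability of H under the
  action enters. For the quotient, stability under B alone is too weak, since dividing A by H
  requires \<open>k \<cdot> h\<close> to be normal in A. The kernel pair of p over A encodes the
  conjugation of G by A, and because \<open>characteristic\<close> quantifies over all acting
  objects, the total object A itself may be taken as the acting one. Protomodularity enters in a
  single form: section and kernel of a split extension jointly generate its middle object. Both the
  equivalence property of reflexive relations and the normality of regular epimorphisms are drawn
  from it.\<close>

definition jointly_monic :: "('o, 'm) cat \<Rightarrow> 'm \<Rightarrow> 'm \<Rightarrow> bool" where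
  "jointly_monic C r1 r2 \<longleftrightarrow> r1 \<in> Arr C \<and> r2 \<in> Hom C (Dom C r1) (Cod C r1) \<and>
    (\<forall>X x y. x \<in> Hom C X (Dom C r1) \<and> y \<in> Hom C X (Dom C r1) \<and>
      r1 \<cdot>\<^bsub>C\<^esub> x = r1 \<cdot>\<^bsub>C\<^esub> y \<and> r2 \<cdot>\<^bsub>C\<^esub> x = r2 \<cdot>\<^bsub>C\<^esub> y \<longrightarrow> x = y)"

context category
begin

lemma Hom_iff: "f \<in> Hom C A B \<longleftrightarrow> f \<in> Arr C \<and> Dom C f = A \<and> Cod C f = B"
  by (auto simp: Hom_def)

lemma Comp_closed:
  assumes "f \<in> Arr C" "g \<in> Arr C" "Cod C f = Dom C g"
  shows "g \<cdot> f \<in> Arr C" "Dom C (g \<cdot> f) = Dom C f" "Cod C (g \<cdot> f) = Cod C g"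
  using Comp_in_Hom[of f "Dom C f" "Dom C g" g "Cod C g"] assms by (auto simp: Hom_iff)

lemma Ide_closed:
  assumes "A \<in> Obj C"
  shows "Ide C A \<in> Arr C" "Dom C (Ide C A) = A" "Cod C (Ide C A) = A"
  using Ide_in_Hom[OF assms] by (auto simp: Hom_iff)

lemma Ide_left: "f \<in> Arr C \<Longrightarrow> Cod C f = B \<Longrightarrow> Ide C B \<cdot> f = f"
  using Comp_Ide_left by (auto simp: Hom_iff)

lemma Ide_right: "f \<in> Arr C \<Longrightarrow> Dom C f = A \<Longrightarrow> f \<cdot> Ide C A = f"
  using Comp_Ide_right by (auto simp: Hom_iff)

lemma Assoc:
  "f \<in> Arr C \<Longrightarrow> g \<in> Arr C \<Longrightarrow> k \<in> Arr C \<Longrightarrow> Cod C f = Dom C g \<Longrightarrow> Cod C g = Dom C k \<Longrightarrow>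
    (k \<cdot> g) \<cdot> f = k \<cdot> (g \<cdot> f)"
  using Comp_assoc by (auto simp: Hom_iff)

text \<open>The simplifier associates composites to the right, so an equation
  \<open>k \<cdot> g = w\<close> no longer matches inside \<open>k \<cdot> (g \<cdot> f)\<close>.
  This form restores the rewrite at the head of a longer composite.\<close>

lemma Comp_eq_extend:
  assumes "k \<cdot> g = w" "f \<in> Arr C" "g \<in> Arr C" "k \<in> Arr C" "Cod C f = Dom C g" "Cod C g = Dom C k"
  shows "k \<cdot> (g \<cdot> f) = w \<cdot> f"
  using Assoc[of f g k] assms by simp

lemmas arrow_simps = Hom_iff Comp_closed Ide_closed Ide_left Ide_right Assoc Dom_in_Obj Cod_in_Obj

declare arrow_simps [simp]

section \<open>Monomorphisms, pullbacks, coequalizers and regular epimorphisms\<close>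

lemma mono_arrow: "is_mono C m \<Longrightarrow> m \<in> Arr C"
  by (simp add: is_mono_def)

lemma mono_cancel:
  assumes "is_mono C m" "f \<in> Arr C" "g \<in> Arr C" "Cod C f = Dom C m" "Cod C g = Dom C m"
    and "m \<cdot> f = m \<cdot> g"
  shows "f = g"
proof -
  note m = mono_arrow[OF assms(1)]
  have "Dom C f = Dom C g"
    using Comp_closed(2)[OF assms(2) m assms(4)] Comp_closed(2)[OF assms(3) m assms(5)] assms(6) by simp
  then have "g \<in> Hom C (Dom C f) (Dom C m)" "f \<in> Hom C (Dom C f) (Dom C m)"
    using assms by auto
  then show ?thesis using assms(1,6) unfolding is_mono_def by blast
qed

lemma monoI:
  assumes "m \<in> Arr C"
    and "\<And>f g. f \<in> Arr C \<Longrightarrow> g \<in> Arr C \<Longrightarrow> Cod C f = Dom C m \<Longrightarrow> Cod C g = Dom C m \<Longrightarrow>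
      Dom C f = Dom C g \<Longrightarrow> m \<cdot> f = m \<cdot> g \<Longrightarrow> f = g"
  shows "is_mono C m"
  unfolding is_mono_def using assms(1) by (auto intro!: assms(2))

lemma isoE:
  assumes "is_iso C f"
  obtains g where "f \<in> Arr C" "g \<in> Arr C" "Dom C g = Cod C f" "Cod C g = Dom C f"
    "g \<cdot> f = Ide C (Dom C f)" "f \<cdot> g = Ide C (Cod C f)"
  using assms by (auto simp: is_iso_def)

lemma pullback_arrows:
  assumes "is_pullback C f g a b"
  shows "f \<in> Arr C" "g \<in> Arr C" "a \<in> Arr C" "b \<in> Arr C" "Cod C f = Cod C g"
    "Cod C a = Dom C f" "Cod C b = Dom C g" "Dom C b = Dom C a" "f \<cdot> a = g \<cdot> b"
  using assms unfolding is_pullback_def Hom_iff by blast+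

lemma pullback_factor:
  assumes "is_pullback C f g a b" "x \<in> Arr C" "y \<in> Arr C" "Dom C x = Dom C y"
    "Cod C x = Dom C f" "Cod C y = Dom C g" "f \<cdot> x = g \<cdot> y"
  obtains u where "u \<in> Arr C" "Dom C u = Dom C x" "Cod C u = Dom C a" "a \<cdot> u = x" "b \<cdot> u = y"
proof -
  have "x \<in> Hom C (Dom C x) (Dom C f)" "y \<in> Hom C (Dom C x) (Dom C g)" using assms by auto
  then have "\<exists>!u. u \<in> Hom C (Dom C x) (Dom C a) \<and> a \<cdot> u = x \<and> b \<cdot> u = y"
    using assms(1,7) unfolding is_pullback_def by blast
  then show thesis using that by auto
qed

lemma pullback_cancel:
  assumes pb: "is_pullback C f g a b" and "x \<in> Arr C" "y \<in> Arr C" "Dom C x = Dom C y"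
    "Cod C x = Dom C a" "Cod C y = Dom C a" "a \<cdot> x = a \<cdot> y" "b \<cdot> x = b \<cdot> y"
  shows "x = y"
proof -
  note [simp] = pullback_arrows[OF pb]
  have "f \<cdot> (a \<cdot> x) = g \<cdot> (b \<cdot> x)"
    using assms Assoc[of x a f] Assoc[of x b g] by simp
  moreover have "a \<cdot> x \<in> Hom C (Dom C x) (Dom C f)" "b \<cdot> x \<in> Hom C (Dom C x) (Dom C g)"
    using assms by auto
  ultimately have "\<exists>!u. u \<in> Hom C (Dom C x) (Dom C a) \<and> a \<cdot> u = a \<cdot> x \<and> b \<cdot> u = b \<cdot> x"
    using pb unfolding is_pullback_def by blast
  moreover have "x \<in> Hom C (Dom C x) (Dom C a)" "y \<in> Hom C (Dom C x) (Dom C a)"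
    using assms by auto
  ultimately show ?thesis using assms(7,8) by metis
qed

lemma pullbackI:
  assumes "f \<in> Arr C" "g \<in> Arr C" "a \<in> Arr C" "b \<in> Arr C" "Cod C f = Cod C g"
    "Cod C a = Dom C f" "Cod C b = Dom C g" "Dom C b = Dom C a" "f \<cdot> a = g \<cdot> b"
    and factor: "\<And>x y. x \<in> Arr C \<Longrightarrow> y \<in> Arr C \<Longrightarrow> Dom C x = Dom C y \<Longrightarrow> Cod C x = Dom C f \<Longrightarrow>
      Cod C y = Dom C g \<Longrightarrow> f \<cdot> x = g \<cdot> y \<Longrightarrow>
      \<exists>u. u \<in> Arr C \<and> Dom C u = Dom C x \<and> Cod C u = Dom C a \<and> a \<cdot> u = x \<and> b \<cdot> u = y"
    and cancel: "\<And>x y. x \<in> Arr C \<Longrightarrow> y \<in> Arr C \<Longrightarrow> Dom C x = Dom C y \<Longrightarrow> Cod C x = Dom C a \<Longrightarrow>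
      Cod C y = Dom C a \<Longrightarrow> a \<cdot> x = a \<cdot> y \<Longrightarrow> b \<cdot> x = b \<cdot> y \<Longrightarrow> x = y"
  shows "is_pullback C f g a b"
  unfolding is_pullback_def
proof (intro conjI allI impI)
  fix X x y
  assume "x \<in> Hom C X (Dom C f) \<and> y \<in> Hom C X (Dom C g) \<and> f \<cdot> x = g \<cdot> y"
  then have "\<exists>u. u \<in> Hom C X (Dom C a) \<and> a \<cdot> u = x \<and> b \<cdot> u = y"
    using factor[of x y] by auto
  moreover have "u = v" if "u \<in> Hom C X (Dom C a)" "v \<in> Hom C X (Dom C a)"
    "a \<cdot> u = a \<cdot> v" "b \<cdot> u = b \<cdot> v" for u v
    by (rule cancel) (use that in auto)
  ultimately show "\<exists>!u. u \<in> Hom C X (Dom C a) \<and> a \<cdot> u = x \<and> b \<cdot> u = y"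
    by metis
qed (use assms(1-9) in auto)

lemma coequalizer_arrows:
  assumes "is_coequalizer C f g e"
  shows "f \<in> Arr C" "g \<in> Arr C" "e \<in> Arr C" "Dom C g = Dom C f" "Cod C g = Cod C f"
    "Dom C e = Cod C f" "e \<cdot> f = e \<cdot> g"
  using assms unfolding is_coequalizer_def Hom_iff by blast+

lemma coequalizer_factor:
  assumes "is_coequalizer C f g e" "x \<in> Arr C" "Dom C x = Cod C f" "x \<cdot> f = x \<cdot> g"
  obtains u where "u \<in> Arr C" "Dom C u = Cod C e" "Cod C u = Cod C x" "u \<cdot> e = x"
proof -
  have "x \<in> Hom C (Cod C f) (Cod C x)" using assms by auto
  then have "\<exists>!u. u \<in> Hom C (Cod C e) (Cod C x) \<and> u \<cdot> e = x"
    using assms(1,4) unfolding is_coequalizer_def by blast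
  then show thesis using that by auto
qed

lemma regular_epi_arrow: "is_regular_epi C e \<Longrightarrow> e \<in> Arr C"
  using coequalizer_arrows by (auto simp: is_regular_epi_def)

lemma regular_epi_cancel:
  assumes "is_regular_epi C e" "x \<in> Arr C" "y \<in> Arr C" "Dom C x = Cod C e" "Dom C y = Cod C e"
    "x \<cdot> e = y \<cdot> e"
  shows "x = y"
proof -
  obtain f g where fg: "is_coequalizer C f g e" using assms(1) by (auto simp: is_regular_epi_def)
  note [simp] = coequalizer_arrows[OF fg]
  have Cod: "Cod C x = Cod C y"
    using Comp_closed(3)[of e x] Comp_closed(3)[of e y] assms by simp
  have "x \<cdot> e \<in> Hom C (Cod C f) (Cod C x)" using assms(2,4) by simp
  moreover have "(x \<cdot> e) \<cdot> f = (x \<cdot> e) \<cdot> g"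
    using assms(2,4) by simp
  ultimately have "\<exists>!u. u \<in> Hom C (Cod C e) (Cod C x) \<and> u \<cdot> e = x \<cdot> e"
    using fg unfolding is_coequalizer_def by blast
  then show ?thesis using assms Cod by auto
qed

text \<open>Diagonal fill-in between regular epimorphisms and monomorphisms: as \<open>m\<close> is
  monic, \<open>u\<close> identifies whatever pair \<open>e\<close> coequalizes, because
  \<open>y \<cdot> e\<close> does, and hence descends along \<open>e\<close>.\<close>

lemma regular_epi_lift:
  assumes e: "is_regular_epi C e" and m: "is_mono C m"
    and [simp]: "u \<in> Arr C" "y \<in> Arr C" "Dom C u = Dom C e" "Cod C u = Dom C m"
      "Dom C y = Cod C e" "Cod C y = Cod C m"
    and sq: "m \<cdot> u = y \<cdot> e"
  obtains v where "v \<in> Arr C" "Dom C v = Cod C e" "Cod C v = Dom C m" "m \<cdot> v = y"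
proof -
  obtain f g where fg: "is_coequalizer C f g e" using e by (auto simp: is_regular_epi_def)
  note [simp] = coequalizer_arrows[OF fg]
  note [simp] = mono_arrow[OF m]
  have uf: "u \<cdot> f = u \<cdot> g"
    by (rule mono_cancel[OF m]) (simp_all add: Comp_eq_extend[OF sq])
  obtain v where v [simp]: "v \<in> Arr C" "Dom C v = Cod C e" "Cod C v = Dom C m" and ve: "v \<cdot> e = u"
    using coequalizer_factor[OF fg _ _ uf] assms(3,5,6) coequalizer_arrows(6)[OF fg] by metis
  have "m \<cdot> v = y" by (rule regular_epi_cancel[OF e]) (simp_all add: ve sq)
  then show thesis using that v by blast
qed

lemma coproduct_cancel:
  assumes cp: "is_coproduct C A B i j" and [simp]: "x \<in> Arr C" "y \<in> Arr C" "Dom C x = Cod C i"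
    "Dom C y = Cod C i" "Cod C x = Cod C y" and "x \<cdot> i = y \<cdot> i" "x \<cdot> j = y \<cdot> j"
  shows "x = y"
proof -
  have [simp]: "i \<in> Arr C" "j \<in> Arr C" "Dom C i = A" "Dom C j = B" "Cod C j = Cod C i"
    using cp unfolding is_coproduct_def Hom_iff by blast+
  have "x \<cdot> i \<in> Hom C A (Cod C x)" "x \<cdot> j \<in> Hom C B (Cod C x)" by simp_all
  then have "\<exists>!u. u \<in> Hom C (Cod C i) (Cod C x) \<and> u \<cdot> i = x \<cdot> i \<and> u \<cdot> j = x \<cdot> j"
    using cp unfolding is_coproduct_def by blast
  moreover have "x \<in> Hom C (Cod C i) (Cod C x)" "y \<in> Hom C (Cod C i) (Cod C x)" by simp_all
  ultimately show ?thesis using assms(7,8) by metis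
qed

end

section \<open>Zero arrows and kernels\<close>

locale pointed_category = category C for C :: "('o, 'm) cat" (structure) +
  assumes pointed: "pointed C"
begin

text \<open>\<open>zero_map\<close> ranges over all zero objects, so its definite description is
  meaningful only if the composite does not depend on the one chosen. The comparison arrow between
  two zero objects fits into both triangles.\<close>

lemma zero_map_unique:
  assumes Z: "is_zero_object C Z" "t \<in> Hom C A Z" "i \<in> Hom C Z B"
    and Z': "is_zero_object C Z'" "t' \<in> Hom C A Z'" "i' \<in> Hom C Z' B"
  shows "i \<cdot> t = i' \<cdot> t'"
proof -
  have obj: "Z \<in> Obj C" "Z' \<in> Obj C" "A \<in> Obj C" "B \<in> Obj C"
    using Dom_in_Obj Cod_in_Obj assms by auto
  obtain j where j: "j \<in> Hom C Z Z'"
    using Z(1) obj unfolding is_zero_object_def is_initial_def by blast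
  have "\<exists>!f. f \<in> Hom C A Z'" using Z'(1) obj unfolding is_zero_object_def is_terminal_def by blast
  moreover have "j \<cdot> t \<in> Hom C A Z'" using j Z by simp
  ultimately have 1: "j \<cdot> t = t'" using Z' by blast
  have "\<exists>!f. f \<in> Hom C Z B" using Z(1) obj unfolding is_zero_object_def is_initial_def by blast
  moreover have "i' \<cdot> j \<in> Hom C Z B" using j Z' by simp
  ultimately have "i' \<cdot> j = i" using Z by blast
  then show ?thesis using 1 j Z Z' Assoc[of t j i'] by auto
qed

lemma zero_map_eq:
  assumes "is_zero_object C Z" "t \<in> Hom C A Z" "i \<in> Hom C Z B"
  shows "zero_map C A B = i \<cdot> t"
  unfolding zero_map_def using zero_map_unique assms by (intro the_equality) blast+

lemma zero_factor:
  assumes "A \<in> Obj C" "B \<in> Obj C"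
  obtains Z t i where "is_zero_object C Z" "t \<in> Hom C A Z" "i \<in> Hom C Z B"
    "zero_map C A B = i \<cdot> t"
proof -
  obtain Z where Z: "is_zero_object C Z" using pointed by (auto simp: pointed_def)
  then obtain t i where ti: "t \<in> Hom C A Z" "i \<in> Hom C Z B"
    using assms unfolding is_zero_object_def is_terminal_def is_initial_def by blast
  show thesis by (rule that[OF Z ti zero_map_eq[OF Z ti]])
qed

lemma zero_map_closed [simp]:
  assumes "A \<in> Obj C" "B \<in> Obj C"
  shows "zero_map C A B \<in> Arr C" "Dom C (zero_map C A B) = A" "Cod C (zero_map C A B) = B"
  by (rule zero_factor[OF assms]; simp)+

lemma Comp_zero [simp]:
  assumes "f \<in> Arr C" "A \<in> Obj C" "B = Dom C f"
  shows "f \<cdot> zero_map C A B = zero_map C A (Cod C f)"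
proof -
  obtain Z t i where Z: "is_zero_object C Z" "t \<in> Hom C A Z" "i \<in> Hom C Z B" "zero_map C A B = i \<cdot> t"
    using zero_factor[of A B] assms by auto
  then have "zero_map C A (Cod C f) = (f \<cdot> i) \<cdot> t" using assms by (intro zero_map_eq) auto
  then show ?thesis using Z assms by simp
qed

lemma zero_Comp [simp]:
  assumes "f \<in> Arr C" "B \<in> Obj C" "A = Cod C f"
  shows "zero_map C A B \<cdot> f = zero_map C (Dom C f) B"
proof -
  obtain Z t i where Z: "is_zero_object C Z" "t \<in> Hom C A Z" "i \<in> Hom C Z B" "zero_map C A B = i \<cdot> t"
    using zero_factor[of A B] assms by auto
  then have "zero_map C (Dom C f) B = i \<cdot> (t \<cdot> f)" using assms by (intro zero_map_eq) auto
  then show ?thesis using Z assms by simp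
qed

lemma into_zero_object:
  assumes "is_zero_object C Z" "f \<in> Arr C" "g \<in> Arr C" "Cod C f = Z" "Cod C g = Z" "Dom C f = Dom C g"
  shows "f = g"
proof -
  have "\<exists>!k. k \<in> Hom C (Dom C f) Z"
    using assms unfolding is_zero_object_def is_terminal_def by simp
  then show ?thesis using assms by auto
qed

lemma kernel_arrows:
  assumes "is_kernel C p k"
  shows "p \<in> Arr C" "k \<in> Arr C" "Cod C k = Dom C p" "p \<cdot> k = zero_map C (Dom C k) (Cod C p)"
  using assms unfolding is_kernel_def Hom_iff by blast+

lemma kernel_factor:
  assumes "is_kernel C p k" "x \<in> Arr C" "Cod C x = Dom C p" "p \<cdot> x = zero_map C (Dom C x) (Cod C p)"
  obtains u where "u \<in> Arr C" "Dom C u = Dom C x" "Cod C u = Dom C k" "k \<cdot> u = x"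
proof -
  have "x \<in> Hom C (Dom C x) (Dom C p)" using assms by auto
  then have "\<exists>!u. u \<in> Hom C (Dom C x) (Dom C k) \<and> k \<cdot> u = x"
    using assms unfolding is_kernel_def by blast
  then show thesis using that by auto
qed

lemma kernel_mono:
  assumes "is_kernel C p k"
  shows "is_mono C k"
proof (rule monoI)
  note [simp] = kernel_arrows[OF assms]
  show "k \<in> Arr C" by simp
  fix f g
  assume [simp]: "f \<in> Arr C" "g \<in> Arr C" "Cod C f = Dom C k" "Cod C g = Dom C k" "Dom C f = Dom C g"
    and eq: "k \<cdot> f = k \<cdot> g"
  have "p \<cdot> (k \<cdot> g) = zero_map C (Dom C g) (Cod C p)"
    by (simp add: Comp_eq_extend[OF kernel_arrows(4)[OF assms]])
  moreover have "k \<cdot> g \<in> Hom C (Dom C g) (Dom C p)" by simp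
  ultimately have "\<exists>!u. u \<in> Hom C (Dom C g) (Dom C k) \<and> k \<cdot> u = k \<cdot> g"
    using assms unfolding is_kernel_def by blast
  moreover have "f \<in> Hom C (Dom C g) (Dom C k)" "g \<in> Hom C (Dom C g) (Dom C k)" by simp_all
  ultimately show "f = g" using eq by metis
qed

lemma kernelI:
  assumes k: "is_mono C k" and "p \<in> Arr C" "Cod C k = Dom C p"
    "p \<cdot> k = zero_map C (Dom C k) (Cod C p)"
    and factor: "\<And>x. x \<in> Arr C \<Longrightarrow> Cod C x = Dom C p \<Longrightarrow> p \<cdot> x = zero_map C (Dom C x) (Cod C p) \<Longrightarrow>
      \<exists>u. u \<in> Arr C \<and> Dom C u = Dom C x \<and> Cod C u = Dom C k \<and> k \<cdot> u = x"
  shows "is_kernel C p k"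
  unfolding is_kernel_def
proof (intro conjI allI impI)
  fix X x
  assume "x \<in> Hom C X (Dom C p) \<and> p \<cdot> x = zero_map C X (Cod C p)"
  then have "x \<in> Arr C" "Dom C x = X" "\<exists>u. u \<in> Hom C X (Dom C k) \<and> k \<cdot> u = x"
    using factor[of x] by auto
  moreover have "u = v" if "u \<in> Hom C X (Dom C k)" "v \<in> Hom C X (Dom C k)" "k \<cdot> u = k \<cdot> v" for u v
    by (rule mono_cancel[OF k]) (use that in auto)
  ultimately show "\<exists>!u. u \<in> Hom C X (Dom C k) \<and> k \<cdot> u = x"
    by metis
qed (use mono_arrow[OF k] assms(2-4) in simp_all)

text \<open>Kernels are pullbacks along the arrow from a zero object. This gives their existence
  from finite completeness, and it makes protomodularity, which is stated for arbitrary changes of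
  base, applicable to kernels.\<close>

lemma kernel_iff_pullback:
  assumes Z: "is_zero_object C Z" and [simp]: "p \<in> Arr C" "k \<in> Arr C" "Cod C k = Dom C p"
  shows "is_kernel C p k \<longleftrightarrow>
    is_pullback C p (zero_map C Z (Cod C p)) k (zero_map C (Dom C k) Z)"
proof
  have [simp]: "Z \<in> Obj C" using Z by (simp add: is_zero_object_def is_initial_def)
  {
    assume k: "is_kernel C p k"
    note [simp] = kernel_arrows(4)[OF k]
    show "is_pullback C p (zero_map C Z (Cod C p)) k (zero_map C (Dom C k) Z)"
    proof (rule pullbackI)
      fix x y
      assume *: "x \<in> Arr C" "y \<in> Arr C" "Dom C x = Dom C y" "Cod C x = Dom C p"
        "Cod C y = Dom C (zero_map C Z (Cod C p))" "p \<cdot> x = zero_map C Z (Cod C p) \<cdot> y"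
      then have "p \<cdot> x = zero_map C (Dom C x) (Cod C p)" by simp
      then obtain u where u: "u \<in> Arr C" "Dom C u = Dom C x" "Cod C u = Dom C k" "k \<cdot> u = x"
        using kernel_factor[OF k, of x] * by blast
      moreover have "zero_map C (Dom C k) Z \<cdot> u = y"
        by (rule into_zero_object[OF Z]) (use u * in auto)
      ultimately show "\<exists>u. u \<in> Arr C \<and> Dom C u = Dom C x \<and> Cod C u = Dom C k \<and> k \<cdot> u = x \<and>
        zero_map C (Dom C k) Z \<cdot> u = y" by blast
    next
      fix x y
      assume "x \<in> Arr C" "y \<in> Arr C" "Cod C x = Dom C k" "Cod C y = Dom C k" "k \<cdot> x = k \<cdot> y"
      then show "x = y" by (rule mono_cancel[OF kernel_mono[OF k]])
    qed auto
  }
  {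
    assume pb: "is_pullback C p (zero_map C Z (Cod C p)) k (zero_map C (Dom C k) Z)"
    show "is_kernel C p k"
    proof (rule kernelI)
      show "is_mono C k"
        by (rule monoI, simp, rule pullback_cancel[OF pb]) auto
      show "p \<cdot> k = zero_map C (Dom C k) (Cod C p)"
        using pullback_arrows(9)[OF pb] by simp
      fix x assume x: "x \<in> Arr C" "Cod C x = Dom C p" "p \<cdot> x = zero_map C (Dom C x) (Cod C p)"
      obtain u where "u \<in> Arr C" "Dom C u = Dom C x" "Cod C u = Dom C k" "k \<cdot> u = x"
        by (rule pullback_factor[OF pb, of x "zero_map C (Dom C x) Z"]) (use x in auto)
      then show "\<exists>u. u \<in> Arr C \<and> Dom C u = Dom C x \<and> Cod C u = Dom C k \<and> k \<cdot> u = x" by blast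
    qed auto
  }
qed

end

section \<open>Semi-abelian categories\<close>

locale semi_abelian_category =
  fixes C :: "('o, 'm) cat" (structure)
  assumes semi_abelian: "semi_abelian C"

sublocale semi_abelian_category \<subseteq> pointed_category
  using semi_abelian
  by (simp add: semi_abelian_def pointed_category_def pointed_category_axioms_def)

context semi_abelian_category
begin

lemma ex_pullback:
  assumes "f \<in> Arr C" "g \<in> Arr C" "Cod C f = Cod C g"
  obtains a b where "is_pullback C f g a b"
  using semi_abelian assms
  unfolding semi_abelian_def exact_category_def regular_category_def finitely_complete_def by blast

lemma ex_kernel_pair_coequalizer:
  assumes "is_pullback C f f a b"
  obtains e where "is_coequalizer C a b e"
  using semi_abelian assms unfolding semi_abelian_def exact_category_def regular_category_def by blast

lemma regular_epi_pullback:
  assumes "is_pullback C f g a b" "is_regular_epi C f"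
  shows "is_regular_epi C b"
  using semi_abelian assms unfolding semi_abelian_def exact_category_def regular_category_def by blast

lemma ex_kernel:
  assumes [simp]: "p \<in> Arr C"
  obtains k where "is_kernel C p k"
proof -
  obtain Z where Z: "is_zero_object C Z" using pointed by (auto simp: pointed_def)
  then have [simp]: "Z \<in> Obj C" by (simp add: is_zero_object_def is_initial_def)
  obtain a b where ab: "is_pullback C p (zero_map C Z (Cod C p)) a b"
    using ex_pullback[of p "zero_map C Z (Cod C p)"] by auto
  note ab' = pullback_arrows[OF ab]
  have "b = zero_map C (Dom C a) Z"
    by (rule into_zero_object[OF Z]) (use ab' in auto)
  then have "is_kernel C p a"
    using kernel_iff_pullback[OF Z, of p a] ab ab' by simp
  then show thesis by (rule that)
qed

text \<open>Any two arrows into a zero object form a commuting cospan, so the pullback over it has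
  the universal property of the product.\<close>

lemma ex_product:
  assumes [simp]: "A \<in> Obj C" "B \<in> Obj C"
  obtains a b where "a \<in> Arr C" "b \<in> Arr C" "Dom C a = Dom C b" "Cod C a = A" "Cod C b = B"
    "\<And>x y. x \<in> Arr C \<Longrightarrow> y \<in> Arr C \<Longrightarrow> Dom C x = Dom C y \<Longrightarrow> Cod C x = A \<Longrightarrow> Cod C y = B \<Longrightarrow>
      \<exists>u. u \<in> Arr C \<and> Dom C u = Dom C x \<and> Cod C u = Dom C a \<and> a \<cdot> u = x \<and> b \<cdot> u = y"
    "\<And>x y. x \<in> Arr C \<Longrightarrow> y \<in> Arr C \<Longrightarrow> Dom C x = Dom C y \<Longrightarrow> Cod C x = Dom C a \<Longrightarrow>
      Cod C y = Dom C a \<Longrightarrow> a \<cdot> x = a \<cdot> y \<Longrightarrow> b \<cdot> x = b \<cdot> y \<Longrightarrow> x = y"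
proof -
  obtain Z where "is_zero_object C Z" using pointed by (auto simp: pointed_def)
  then have [simp]: "Z \<in> Obj C" by (simp add: is_zero_object_def is_initial_def)
  obtain a b where ab: "is_pullback C (zero_map C A Z) (zero_map C B Z) a b"
    using ex_pullback[of "zero_map C A Z" "zero_map C B Z"] by auto
  note ab' = pullback_arrows[OF ab]
  show thesis
  proof (rule that[of a b])
    fix x y
    assume *: "x \<in> Arr C" "y \<in> Arr C" "Dom C x = Dom C y" "Cod C x = A" "Cod C y = B"
    obtain u where "u \<in> Arr C" "Dom C u = Dom C x" "Cod C u = Dom C a" "a \<cdot> u = x" "b \<cdot> u = y"
      by (rule pullback_factor[OF ab, of x y]) (use * in auto)
    then show "\<exists>u. u \<in> Arr C \<and> Dom C u = Dom C x \<and> Cod C u = Dom C a \<and> a \<cdot> u = x \<and> b \<cdot> u = y"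
      by blast
  next
    fix x y
    assume "x \<in> Arr C" "y \<in> Arr C" "Dom C x = Dom C y" "Cod C x = Dom C a" "Cod C y = Dom C a"
      "a \<cdot> x = a \<cdot> y" "b \<cdot> x = b \<cdot> y"
    then show "x = y" by (rule pullback_cancel[OF ab])
  qed (use ab' in auto)
qed

section \<open>Relations as jointly monic pairs, and their inverse images\<close>

lemma jointly_monicD:
  assumes "jointly_monic C r1 r2"
  shows "r1 \<in> Arr C" "r2 \<in> Arr C" "Dom C r2 = Dom C r1" "Cod C r2 = Cod C r1"
  using assms unfolding jointly_monic_def Hom_iff by blast+

lemma jointly_monic_cancel:
  assumes "jointly_monic C r1 r2" "x \<in> Arr C" "y \<in> Arr C" "Dom C x = Dom C y"
    "Cod C x = Dom C r1" "Cod C y = Dom C r1" "r1 \<cdot> x = r1 \<cdot> y" "r2 \<cdot> x = r2 \<cdot> y"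
  shows "x = y"
  using assms unfolding jointly_monic_def Hom_iff by blast

text \<open>Here \<open>m\<close> is the subobject of those elements x for which y(x) R z(x), and
  \<open>u\<close> is the proof of relatedness over it. It is the pullback of \<rho> = (r1, r2) : R
  -> A x A along \<sigma> = (y, z), with A the common codomain of \<open>r1\<close> and
  \<open>r2\<close>.\<close>

lemma relation_inverse_image:
  assumes jm: "jointly_monic C r1 r2"
    and [simp]: "y \<in> Arr C" "z \<in> Arr C" "Dom C z = Dom C y" "Cod C y = Cod C r1" "Cod C z = Cod C r1"
  obtains m u where "is_mono C m" "Cod C m = Dom C y" "u \<in> Arr C" "Dom C u = Dom C m"
    "Cod C u = Dom C r1" "r1 \<cdot> u = y \<cdot> m" "r2 \<cdot> u = z \<cdot> m"
    "\<And>x v. x \<in> Arr C \<Longrightarrow> v \<in> Arr C \<Longrightarrow> Cod C x = Dom C y \<Longrightarrow> Cod C v = Dom C r1 \<Longrightarrow>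
      Dom C v = Dom C x \<Longrightarrow> r1 \<cdot> v = y \<cdot> x \<Longrightarrow> r2 \<cdot> v = z \<cdot> x \<Longrightarrow>
      \<exists>w. w \<in> Arr C \<and> Dom C w = Dom C x \<and> Cod C w = Dom C m \<and> m \<cdot> w = x"
proof -
  note [simp] = jointly_monicD[OF jm]
  obtain a b where [simp]: "a \<in> Arr C" "b \<in> Arr C" "Dom C a = Dom C b" "Cod C a = Cod C r1"
      "Cod C b = Cod C r1"
    and pair: "\<And>x y. x \<in> Arr C \<Longrightarrow> y \<in> Arr C \<Longrightarrow> Dom C x = Dom C y \<Longrightarrow> Cod C x = Cod C r1 \<Longrightarrow>
      Cod C y = Cod C r1 \<Longrightarrow>
      \<exists>u. u \<in> Arr C \<and> Dom C u = Dom C x \<and> Cod C u = Dom C a \<and> a \<cdot> u = x \<and> b \<cdot> u = y"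
    and cancel: "\<And>x y. x \<in> Arr C \<Longrightarrow> y \<in> Arr C \<Longrightarrow> Dom C x = Dom C y \<Longrightarrow> Cod C x = Dom C a \<Longrightarrow>
      Cod C y = Dom C a \<Longrightarrow> a \<cdot> x = a \<cdot> y \<Longrightarrow> b \<cdot> x = b \<cdot> y \<Longrightarrow> x = y"
    by (rule ex_product[of "Cod C r1" "Cod C r1"]) simp_all
  obtain \<rho> where \<rho> [simp]: "\<rho> \<in> Arr C" "Dom C \<rho> = Dom C r1" "Cod C \<rho> = Dom C b"
    and a\<rho>: "a \<cdot> \<rho> = r1" and b\<rho>: "b \<cdot> \<rho> = r2"
    using pair[of r1 r2] by auto
  obtain \<sigma> where \<sigma> [simp]: "\<sigma> \<in> Arr C" "Dom C \<sigma> = Dom C y" "Cod C \<sigma> = Dom C b"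
    and a\<sigma>: "a \<cdot> \<sigma> = y" and b\<sigma>: "b \<cdot> \<sigma> = z"
    using pair[of y z] by auto
  obtain m u where pb: "is_pullback C \<sigma> \<rho> m u" by (rule ex_pullback[of \<sigma> \<rho>]) auto
  note [simp] = pullback_arrows(3,4,6,7,8)[OF pb]
  note mu = pullback_arrows(9)[OF pb]
  have r1u: "r1 \<cdot> u = y \<cdot> m"
    using Assoc[of u \<rho> a] Assoc[of m \<sigma> a] by (simp add: a\<rho> a\<sigma> mu)
  have r2u: "r2 \<cdot> u = z \<cdot> m"
    using Assoc[of u \<rho> b] Assoc[of m \<sigma> b] by (simp add: b\<rho> b\<sigma> mu)
  show thesis
  proof (rule that[of m u])
    show "is_mono C m"
    proof (rule monoI)
      fix f g
      assume [simp]: "f \<in> Arr C" "g \<in> Arr C" "Cod C f = Dom C m" "Cod C g = Dom C m" "Dom C f = Dom C g"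
        and eq: "m \<cdot> f = m \<cdot> g"
      have "u \<cdot> f = u \<cdot> g"
        by (rule jointly_monic_cancel[OF jm])
          (simp_all add: eq Comp_eq_extend[OF r1u] Comp_eq_extend[OF r2u])
      then show "f = g"
        by (intro pullback_cancel[OF pb, of f g]) (simp_all add: eq)
    qed simp
  next
    fix x v
    assume [simp]: "x \<in> Arr C" "v \<in> Arr C" "Cod C x = Dom C y" "Cod C v = Dom C r1"
      "Dom C v = Dom C x" and eq: "r1 \<cdot> v = y \<cdot> x" "r2 \<cdot> v = z \<cdot> x"
    have "\<sigma> \<cdot> x = \<rho> \<cdot> v"
      by (rule cancel) (simp_all add: Comp_eq_extend[OF a\<rho>] Comp_eq_extend[OF a\<sigma>]
        Comp_eq_extend[OF b\<rho>] Comp_eq_extend[OF b\<sigma>] eq)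
    then obtain w where "w \<in> Arr C" "Dom C w = Dom C x" "Cod C w = Dom C m" "m \<cdot> w = x"
      using pullback_factor[OF pb, of x v] by auto
    then show "\<exists>w. w \<in> Arr C \<and> Dom C w = Dom C x \<and> Cod C w = Dom C m \<and> m \<cdot> w = x" by blast
  qed (simp_all add: r1u r2u)
qed

section \<open>Split extensions, protomodularity and reflexive relations\<close>

lemma split_extension_arrows:
  assumes "is_split_extension C X B k p s"
  shows "p \<in> Arr C" "s \<in> Arr C" "k \<in> Arr C" "Cod C p = B" "Dom C s = B" "Cod C s = Dom C p"
    "Dom C k = X" "Cod C k = Dom C p" "p \<cdot> s = Ide C B" "p \<cdot> k = zero_map C X B"
    "is_kernel C p k" "B \<in> Obj C" "X \<in> Obj C"
proof -
  have *: "is_point C B p s" "is_kernel C p k" "Dom C k = X"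
    using assms unfolding is_split_extension_def by blast+
  then show "p \<in> Arr C" "s \<in> Arr C" "k \<in> Arr C" "Cod C p = B" "Dom C s = B" "Cod C s = Dom C p"
    "Dom C k = X" "Cod C k = Dom C p" "p \<cdot> s = Ide C B" "is_kernel C p k"
    unfolding is_point_def is_kernel_def Hom_iff by blast+
  then show "p \<cdot> k = zero_map C X B" "B \<in> Obj C" "X \<in> Obj C"
    using kernel_arrows(4)[OF *(2)] by auto
qed

text \<open>A subobject \<open>m\<close> through which both \<open>s\<close> and \<open>k\<close>
  factor is itself the total object of a point over B, namely \<open>p \<cdot> m\<close> with
  section \<open>s0\<close>, and \<open>k0\<close> is its kernel. Change of base along 0 -> B
  therefore sends \<open>m\<close> to the identity of X, and protomodularity reflects this
  isomorphism.\<close>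

lemma split_extension_strongly_epic:
  assumes ext: "is_split_extension C X B k p s" and m: "is_mono C m"
    and [simp]: "Cod C m = Dom C p" "s0 \<in> Arr C" "k0 \<in> Arr C" "Dom C s0 = B" "Dom C k0 = X"
      "Cod C s0 = Dom C m" "Cod C k0 = Dom C m"
    and ms: "m \<cdot> s0 = s" and mk: "m \<cdot> k0 = k"
  shows "is_iso C m"
proof -
  note [simp] = split_extension_arrows[OF ext] mono_arrow[OF m]
  note ker = split_extension_arrows(11)[OF ext]
  obtain Z where Z: "is_zero_object C Z" using pointed by (auto simp: pointed_def)
  then have [simp]: "Z \<in> Obj C" by (simp add: is_zero_object_def is_initial_def)
  have "is_kernel C (p \<cdot> m) k0"
  proof (rule kernelI)
    show "is_mono C k0"
    proof (rule monoI)
      fix f g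
      assume [simp]: "f \<in> Arr C" "g \<in> Arr C" "Cod C f = Dom C k0" "Cod C g = Dom C k0"
        "Dom C f = Dom C g" and eq: "k0 \<cdot> f = k0 \<cdot> g"
      show "f = g"
        by (rule mono_cancel[OF kernel_mono[OF ker]])
          (simp_all add: Comp_eq_extend[OF mk, symmetric] eq)
    qed simp
    fix x
    assume [simp]: "x \<in> Arr C" "Cod C x = Dom C (p \<cdot> m)"
      and "(p \<cdot> m) \<cdot> x = zero_map C (Dom C x) (Cod C (p \<cdot> m))"
    then obtain u where [simp]: "u \<in> Arr C" "Dom C u = Dom C x" "Cod C u = X" and ku: "k \<cdot> u = m \<cdot> x"
      using kernel_factor[OF ker, of "m \<cdot> x"] by auto
    have "k0 \<cdot> u = x"
      by (rule mono_cancel[OF m]) (simp_all add: Comp_eq_extend[OF mk] ku)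
    then show "\<exists>u. u \<in> Arr C \<and> Dom C u = Dom C x \<and> Cod C u = Dom C k0 \<and> k0 \<cdot> u = x"
      by (intro exI[of _ u]) simp
  qed (simp_all add: mk)
  then have "is_pullback C (p \<cdot> m) (zero_map C Z B) k0 (zero_map C X Z)"
    using kernel_iff_pullback[OF Z, of "p \<cdot> m" k0] by simp
  moreover have "is_pullback C p (zero_map C Z B) k (zero_map C X Z)"
    using kernel_iff_pullback[OF Z, of p k] ker by simp
  moreover have "is_point C B (p \<cdot> m) s0" "is_point C B p s" "is_point_morphism C (p \<cdot> m) s0 p s m"
    by (simp_all add: is_point_def is_point_morphism_def ms)
  moreover have "Ide C X \<in> Hom C (Dom C k0) (Dom C k)" "k \<cdot> Ide C X = m \<cdot> k0"
    "zero_map C X Z \<cdot> Ide C X = zero_map C X Z" "is_iso C (Ide C X)"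
    by (auto simp: mk is_iso_def Ide_right intro!: bexI[of _ "Ide C X"])
  moreover have "protomodular C" using semi_abelian by (simp add: semi_abelian_def)
  ultimately show ?thesis unfolding protomodular_def by blast
qed

text \<open>An induction principle on generators: the subobject where \<open>y\<close> and
  \<open>z\<close> are R-related contains the section and the kernel, hence is everything. The
  arrows \<open>u\<close> and \<open>v\<close> witness relatedness on these two.\<close>

lemma split_extension_into_relation:
  assumes ext: "is_split_extension C X B k p s" and jm: "jointly_monic C r1 r2"
    and [simp]: "y \<in> Arr C" "z \<in> Arr C" "Dom C y = Dom C p" "Dom C z = Dom C p"
      "Cod C y = Cod C r1" "Cod C z = Cod C r1"
    and [simp]: "u \<in> Arr C" "v \<in> Arr C" "Dom C u = B" "Dom C v = X" "Cod C u = Dom C r1"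
      "Cod C v = Dom C r1"
    and eqs: "r1 \<cdot> u = y \<cdot> s" "r2 \<cdot> u = z \<cdot> s" "r1 \<cdot> v = y \<cdot> k" "r2 \<cdot> v = z \<cdot> k"
  obtains t where "t \<in> Arr C" "Dom C t = Dom C p" "Cod C t = Dom C r1" "r1 \<cdot> t = y" "r2 \<cdot> t = z"
proof -
  note [simp] = split_extension_arrows[OF ext] jointly_monicD[OF jm]
  obtain m w where m: "is_mono C m" and [simp]: "Cod C m = Dom C y" "w \<in> Arr C" "Dom C w = Dom C m"
      "Cod C w = Dom C r1" and w: "r1 \<cdot> w = y \<cdot> m" "r2 \<cdot> w = z \<cdot> m"
    and factor: "\<And>x v. x \<in> Arr C \<Longrightarrow> v \<in> Arr C \<Longrightarrow> Cod C x = Dom C y \<Longrightarrow> Cod C v = Dom C r1 \<Longrightarrow>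
      Dom C v = Dom C x \<Longrightarrow> r1 \<cdot> v = y \<cdot> x \<Longrightarrow> r2 \<cdot> v = z \<cdot> x \<Longrightarrow>
      \<exists>w. w \<in> Arr C \<and> Dom C w = Dom C x \<and> Cod C w = Dom C m \<and> m \<cdot> w = x"
    by (rule relation_inverse_image[OF jm, of y z]) simp_all
  note [simp] = mono_arrow[OF m]
  obtain s0 where "s0 \<in> Arr C" "Dom C s0 = B" "Cod C s0 = Dom C m" "m \<cdot> s0 = s"
    using factor[of s u] eqs by auto
  moreover obtain k0 where "k0 \<in> Arr C" "Dom C k0 = X" "Cod C k0 = Dom C m" "m \<cdot> k0 = k"
    using factor[of k v] eqs by auto
  ultimately have "is_iso C m"
    by (intro split_extension_strongly_epic[OF ext m, of s0 k0]) simp_all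
  then obtain g where [simp]: "g \<in> Arr C" "Dom C g = Dom C p" "Cod C g = Dom C m"
    and mg: "m \<cdot> g = Ide C (Dom C p)"
    by (rule isoE) simp_all
  show thesis
    by (rule that[of "w \<cdot> g"]) (simp_all add: Comp_eq_extend[OF w(1)] Comp_eq_extend[OF w(2)] mg Ide_right)
qed

text \<open>The preceding principle applied to the equality relation, both of whose legs are
  identities.\<close>

lemma split_extension_jointly_epic:
  assumes ext: "is_split_extension C X B k p s"
    and [simp]: "y \<in> Arr C" "z \<in> Arr C" "Dom C y = Dom C p" "Dom C z = Dom C p" "Cod C y = Cod C z"
    and eqs: "y \<cdot> s = z \<cdot> s" "y \<cdot> k = z \<cdot> k"
  shows "y = z"
proof -
  note [simp] = split_extension_arrows[OF ext]
  have jm: "jointly_monic C (Ide C (Cod C z)) (Ide C (Cod C z))"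
    by (auto simp: jointly_monic_def Ide_left)
  show ?thesis
  proof (rule split_extension_into_relation[OF ext jm, of y z "z \<cdot> s" "z \<cdot> k"])
    fix t
    assume "t \<in> Arr C" "Cod C t = Dom C (Ide C (Cod C z))" "Ide C (Cod C z) \<cdot> t = y" "Ide C (Cod C z) \<cdot> t = z"
    then show "y = z" by metis
  qed (simp_all add: eqs)
qed

text \<open>
  The kernel pair of \<open>r1\<close> consists of the triples \<open>(x, y, z)\<close> with \<open>x R y\<close> and \<open>x R z\<close>. Since \<open>R\<close> is
  reflexive, \<open>y R z\<close> holds on its diagonal and on the kernel of \<open>(x, y, z) \<mapsto> (x, y)\<close>, hence
  everywhere by protomodularity.
\<close>

lemma reflexive_relation_euclidean:
  assumes jm: "jointly_monic C r1 r2"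
    and d [simp]: "d \<in> Arr C" "Dom C d = Cod C r1" "Cod C d = Dom C r1"
    and r1d: "r1 \<cdot> d = Ide C (Cod C r1)" and r2d: "r2 \<cdot> d = Ide C (Cod C r1)"
    and xy: "x \<in> Arr C" "y \<in> Arr C" "Dom C x = Dom C y" "Cod C x = Dom C r1" "Cod C y = Dom C r1"
      "r1 \<cdot> x = r1 \<cdot> y"
  obtains w where "w \<in> Arr C" "Dom C w = Dom C x" "Cod C w = Dom C r1" "r1 \<cdot> w = r2 \<cdot> x" "r2 \<cdot> w = r2 \<cdot> y"
proof -
  note [simp] = jointly_monicD[OF jm]
  obtain a b where pb: "is_pullback C r1 r1 a b" by (rule ex_pullback[of r1 r1]) simp_all
  note [simp] = pullback_arrows(3,4,6,7,8)[OF pb]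
  note ab = pullback_arrows(9)[OF pb]
  obtain \<delta> where [simp]: "\<delta> \<in> Arr C" "Dom C \<delta> = Dom C r1" "Cod C \<delta> = Dom C a"
    and \<delta>: "a \<cdot> \<delta> = Ide C (Dom C r1)" "b \<cdot> \<delta> = Ide C (Dom C r1)"
    by (rule pullback_factor[OF pb, of "Ide C (Dom C r1)" "Ide C (Dom C r1)"]) simp_all
  obtain k where k: "is_kernel C a k" by (rule ex_kernel[of a]) simp_all
  note [simp] = kernel_arrows(2,3)[OF k]
  have ak: "a \<cdot> k = zero_map C (Dom C k) (Dom C r1)" using kernel_arrows(4)[OF k] by simp
  have r1bk: "r1 \<cdot> (b \<cdot> k) = zero_map C (Dom C k) (Cod C r1)"
    using Comp_eq_extend[OF ab[symmetric], of k] by (simp add: ak)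
  have ext: "is_split_extension C (Dom C k) (Dom C r1) k a \<delta>"
    by (simp add: is_split_extension_def is_point_def k \<delta>)
  \<comment> \<open>On the diagonal the required y R y is reflexivity, witnessed by
    \<open>d \<cdot> r2\<close>. On the kernel x and y vanish, so the element (0, z) of R picked out
    by \<open>b \<cdot> k\<close> already says y R z.\<close>
  obtain t where [simp]: "t \<in> Arr C" "Dom C t = Dom C a" "Cod C t = Dom C r1"
    and r1t: "r1 \<cdot> t = r2 \<cdot> a" and r2t: "r2 \<cdot> t = r2 \<cdot> b"
    by (rule split_extension_into_relation[OF ext jm, of "r2 \<cdot> a" "r2 \<cdot> b" "d \<cdot> r2" "b \<cdot> k"])
      (simp_all add: \<delta> ak r1bk Comp_eq_extend[OF r1d] Comp_eq_extend[OF r2d])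
  obtain v where [simp]: "v \<in> Arr C" "Dom C v = Dom C x" "Cod C v = Dom C a"
    and v: "a \<cdot> v = x" "b \<cdot> v = y"
    by (rule pullback_factor[OF pb, of x y]) (use xy in simp_all)
  show thesis
    by (rule that[of "t \<cdot> v"]) (simp_all add: Comp_eq_extend[OF r1t] Comp_eq_extend[OF r2t] v)
qed

text \<open>The Mal'tsev property. For a reflexive relation, the Euclidean law "x R y and x R z
  imply y R z" yields both symmetry and transitivity.\<close>

lemma reflexive_relation_is_equivalence:
  assumes jm: "jointly_monic C r1 r2"
    and d [simp]: "d \<in> Arr C" "Dom C d = Cod C r1" "Cod C d = Dom C r1"
    and r1d: "r1 \<cdot> d = Ide C (Cod C r1)" and r2d: "r2 \<cdot> d = Ide C (Cod C r1)"
  shows "is_equivalence_relation C r1 r2"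
proof -
  note [simp] = jointly_monicD[OF jm]
  \<comment> \<open>Symmetry: the Euclidean law for x R y and the reflexive instance x R x, given by
    \<open>d \<cdot> r1\<close>, yields y R x.\<close>
  obtain c where c [simp]: "c \<in> Arr C" "Dom C c = Dom C r1" "Cod C c = Dom C r1"
    and r1c: "r1 \<cdot> c = r2" and r2c: "r2 \<cdot> c = r1"
  proof (rule reflexive_relation_euclidean[OF jm d r1d r2d, of "Ide C (Dom C r1)" "d \<cdot> r1"])
    fix w
    assume "w \<in> Arr C" "Dom C w = Dom C (Ide C (Dom C r1))" "Cod C w = Dom C r1"
      "r1 \<cdot> w = r2 \<cdot> Ide C (Dom C r1)" "r2 \<cdot> w = r2 \<cdot> (d \<cdot> r1)"
    then show thesis
      by (intro that[of w]) (simp_all add: Comp_eq_extend[OF r2d])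
  qed (simp_all add: Comp_eq_extend[OF r1d])
  \<comment> \<open>Transitivity: from x R y and y R z, first turn the former into y R x by means of
    \<open>c\<close>; the Euclidean law for y R x and y R z then gives x R z.\<close>
  have "\<exists>t \<in> Hom C (Dom C a) (Dom C r1). r1 \<cdot> t = r1 \<cdot> a \<and> r2 \<cdot> t = r2 \<cdot> b"
    if pb: "is_pullback C r2 r1 a b" for a b
  proof (rule reflexive_relation_euclidean[OF jm d r1d r2d, of "c \<cdot> a" b])
    note [simp] = pullback_arrows(3,4,6,7,8)[OF pb]
    show "r1 \<cdot> (c \<cdot> a) = r1 \<cdot> b"
      using pullback_arrows(9)[OF pb] by (simp add: Comp_eq_extend[OF r1c])
    fix w
    assume "w \<in> Arr C" "Dom C w = Dom C (c \<cdot> a)" "Cod C w = Dom C r1"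
      "r1 \<cdot> w = r2 \<cdot> (c \<cdot> a)" "r2 \<cdot> w = r2 \<cdot> b"
    then show ?thesis
      by (intro bexI[of _ w]) (simp_all add: Comp_eq_extend[OF r2c])
  qed (use pullback_arrows(3,4,6,7,8)[OF pb] in simp_all)
  moreover have "\<exists>d \<in> Hom C (Cod C r1) (Dom C r1). r1 \<cdot> d = Ide C (Cod C r1) \<and> r2 \<cdot> d = Ide C (Cod C r1)"
    using r1d r2d by (intro bexI[of _ d]) simp_all
  moreover have "\<exists>c \<in> Hom C (Dom C r1) (Dom C r1). r1 \<cdot> c = r2 \<and> r2 \<cdot> c = r1"
    using r1c r2c by (intro bexI[of _ c]) simp_all
  ultimately show ?thesis
    using jm unfolding is_equivalence_relation_def jointly_monic_def by blast
qed

text \<open>Exactness supplies some \<open>f\<close> with kernel pair (r1, r2), but \<open>f\<close>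
  may fail to be a regular epimorphism. Its factorization through the coequalizer \<open>e\<close>
  of that pair shows that \<open>e\<close> identifies no more than \<open>f\<close> does, so
  \<open>e\<close> has the same kernel pair.\<close>

lemma effective:
  assumes "is_equivalence_relation C r1 r2"
  obtains e where "is_coequalizer C r1 r2 e" "is_pullback C e e r1 r2"
proof -
  obtain f where f: "is_pullback C f f r1 r2"
    using semi_abelian assms unfolding semi_abelian_def exact_category_def by blast
  obtain e where e: "is_coequalizer C r1 r2 e" by (rule ex_kernel_pair_coequalizer[OF f])
  note [simp] = pullback_arrows(1-4,6-8)[OF f] coequalizer_arrows(1-6)[OF e]
  obtain g where [simp]: "g \<in> Arr C" "Dom C g = Cod C e" "Cod C g = Cod C f" and ge: "g \<cdot> e = f"
    by (rule coequalizer_factor[OF e pullback_arrows(1)[OF f] _ pullback_arrows(9)[OF f]])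
      (simp, rule that)
  have "is_pullback C e e r1 r2"
  proof (rule pullbackI)
    show "e \<cdot> r1 = e \<cdot> r2" by (rule coequalizer_arrows(7)[OF e])
    fix x y
    assume xy: "x \<in> Arr C" "y \<in> Arr C" "Dom C x = Dom C y" "Cod C x = Dom C e" "Cod C y = Dom C e"
      "e \<cdot> x = e \<cdot> y"
    have "f \<cdot> x = f \<cdot> y"
      using Comp_eq_extend[OF ge, of x] Comp_eq_extend[OF ge, of y] xy by simp
    then show "\<exists>u. u \<in> Arr C \<and> Dom C u = Dom C x \<and> Cod C u = Dom C r1 \<and> r1 \<cdot> u = x \<and> r2 \<cdot> u = y"
      using pullback_factor[OF f, of x y] xy by (metis coequalizer_arrows(6)[OF e] pullback_arrows(6)[OF f])
  next
    fix x y
    assume "x \<in> Arr C" "y \<in> Arr C" "Dom C x = Dom C y" "Cod C x = Dom C r1" "Cod C y = Dom C r1"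
      "r1 \<cdot> x = r1 \<cdot> y" "r2 \<cdot> x = r2 \<cdot> y"
    then show "x = y" by (rule pullback_cancel[OF f])
  qed simp_all
  with e show thesis by (rule that)
qed

section \<open>Images as quotients by kernel pairs\<close>

lemma image_factorization:
  assumes [simp]: "f \<in> Arr C"
  obtains e m where "is_regular_epi C e" "is_mono C m" "Dom C e = Dom C f" "Cod C e = Dom C m"
    "Cod C m = Cod C f" "m \<cdot> e = f"
proof -
  obtain a b where pb: "is_pullback C f f a b" by (rule ex_pullback[of f f]) simp_all
  obtain e where coeq: "is_coequalizer C a b e" by (rule ex_kernel_pair_coequalizer[OF pb])
  then have e: "is_regular_epi C e" by (auto simp: is_regular_epi_def)
  note [simp] = pullback_arrows(3,4,6-8)[OF pb] coequalizer_arrows(3,6)[OF coeq]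
  note eab = coequalizer_arrows(7)[OF coeq]
  obtain m where [simp]: "m \<in> Arr C" "Dom C m = Cod C e" "Cod C m = Cod C f" and me: "m \<cdot> e = f"
    by (rule coequalizer_factor[OF coeq, of f]) (simp_all add: pullback_arrows(9)[OF pb])
  have "is_mono C m"
  proof (rule monoI)
    fix x y
    assume [simp]: "x \<in> Arr C" "y \<in> Arr C" "Cod C x = Dom C m" "Cod C y = Dom C m" "Dom C x = Dom C y"
      and mxy: "m \<cdot> x = m \<cdot> y"
    \<comment> \<open>\<open>x\<close> and \<open>y\<close> cannot be lifted along \<open>e\<close>
      directly. Two successive pullbacks give lifts \<open>x1 \<cdot> e2\<close> and
      \<open>y1\<close> over the common cover \<open>e1 \<cdot> e2\<close>. As \<open>m\<close>
      identifies \<open>x\<close> and \<open>y\<close>, the lifts agree under \<open>f\<close>, so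
      they form an element of its kernel pair and \<open>e\<close> identifies them; the covers are
      then cancelled one by one.\<close>
    obtain x1 e1 where pb1: "is_pullback C e x x1 e1" by (rule ex_pullback[of e x]) simp_all
    note e1 = regular_epi_pullback[OF pb1 e]
    note [simp] = pullback_arrows(3,4,6-8)[OF pb1]
    note ex1 = pullback_arrows(9)[OF pb1]
    obtain y1 e2 where pb2: "is_pullback C e (y \<cdot> e1) y1 e2"
      by (rule ex_pullback[of e "y \<cdot> e1"]) simp_all
    note e2 = regular_epi_pullback[OF pb2 e]
    have [simp]: "y1 \<in> Arr C" "e2 \<in> Arr C" "Cod C y1 = Cod C a" "Cod C e2 = Dom C x1" "Dom C e2 = Dom C y1"
      and ey1: "e \<cdot> y1 = y \<cdot> (e1 \<cdot> e2)"
      using pullback_arrows(3,4,6-9)[OF pb2] by simp_all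
    have "f \<cdot> (x1 \<cdot> e2) = f \<cdot> y1"
      using Comp_eq_extend[OF me, of "x1 \<cdot> e2"] Comp_eq_extend[OF me, of y1]
      by (simp add: Comp_eq_extend[OF ex1] ey1 Comp_eq_extend[OF mxy])
    then obtain u where [simp]: "u \<in> Arr C" "Cod C u = Dom C a" and u: "a \<cdot> u = x1 \<cdot> e2" "b \<cdot> u = y1"
      using pullback_factor[OF pb, of "x1 \<cdot> e2" y1] by auto
    have "e \<cdot> (x1 \<cdot> e2) = e \<cdot> y1"
      using Comp_eq_extend[OF eab, of u] by (simp add: u)
    then have "x \<cdot> (e1 \<cdot> e2) = y \<cdot> (e1 \<cdot> e2)"
      by (simp add: Comp_eq_extend[OF ex1] ey1)
    then have "x \<cdot> e1 = y \<cdot> e1"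
      by (intro regular_epi_cancel[OF e2, of "x \<cdot> e1" "y \<cdot> e1"]) simp_all
    then show "x = y"
      by (intro regular_epi_cancel[OF e1, of x y]) simp_all
  qed simp
  then show thesis by (rule that[OF e]) (simp_all add: me)
qed

section \<open>Internal actions\<close>

lemma coproduct_injections:
  assumes "A \<in> Obj C" "B \<in> Obj C"
  shows "is_coproduct C A B (inl C A B) (inr C A B)"
proof -
  obtain i j where "is_coproduct C A B i j"
    using semi_abelian assms unfolding semi_abelian_def has_finite_coproducts_def by blast
  then have "case (i, j) of (i, j) \<Rightarrow> is_coproduct C A B i j" by simp
  then have "case coprod_inj C A B of (i, j) \<Rightarrow> is_coproduct C A B i j"
    unfolding coprod_inj_def by (rule someI)
  then show ?thesis by (simp add: inl_def inr_def case_prod_beta)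
qed

lemma injection_arrows [simp]:
  assumes "A \<in> Obj C" "B \<in> Obj C"
  shows "inl C A B \<in> Arr C" "inr C A B \<in> Arr C" "Dom C (inl C A B) = A" "Dom C (inr C A B) = B"
    "Cod C (inl C A B) = coprod C A B" "Cod C (inr C A B) = coprod C A B"
  using coproduct_injections[OF assms] unfolding is_coproduct_def Hom_iff coprod_def by blast+

lemma coprod_cancel:
  assumes "A \<in> Obj C" "B \<in> Obj C" "x \<in> Arr C" "y \<in> Arr C" "Dom C x = coprod C A B"
    "Dom C y = coprod C A B" "Cod C x = Cod C y" "x \<cdot> inl C A B = y \<cdot> inl C A B"
    "x \<cdot> inr C A B = y \<cdot> inr C A B"
  shows "x = y"
  by (rule coproduct_cancel[OF coproduct_injections[OF assms(1,2)]]) (use assms in simp_all)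

lemma copair:
  assumes "f \<in> Arr C" "g \<in> Arr C" "Cod C f = Cod C g"
  shows "copair C f g \<in> Arr C" "Dom C (copair C f g) = coprod C (Dom C f) (Dom C g)"
    "Cod C (copair C f g) = Cod C g"
    "copair C f g \<cdot> inl C (Dom C f) (Dom C g) = f" "copair C f g \<cdot> inr C (Dom C f) (Dom C g) = g"
proof -
  have cp: "is_coproduct C (Dom C f) (Dom C g) (inl C (Dom C f) (Dom C g)) (inr C (Dom C f) (Dom C g))"
    by (rule coproduct_injections) (use assms in simp_all)
  have "f \<in> Hom C (Dom C f) (Cod C f)" "g \<in> Hom C (Dom C g) (Cod C f)" using assms by simp_all
  then have "\<exists>!u. u \<in> Hom C (coprod C (Dom C f) (Dom C g)) (Cod C f) \<and>
      u \<cdot> inl C (Dom C f) (Dom C g) = f \<and> u \<cdot> inr C (Dom C f) (Dom C g) = g"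
    using cp unfolding is_coproduct_def coprod_def by blast
  from theI'[OF this] have u: "copair C f g \<in> Hom C (coprod C (Dom C f) (Dom C g)) (Cod C f)"
    "copair C f g \<cdot> inl C (Dom C f) (Dom C g) = f" "copair C f g \<cdot> inr C (Dom C f) (Dom C g) = g"
    unfolding copair_def[symmetric] by blast+
  show "copair C f g \<cdot> inl C (Dom C f) (Dom C g) = f" "copair C f g \<cdot> inr C (Dom C f) (Dom C g) = g"
    by (rule u)+
  show "copair C f g \<in> Arr C" "Dom C (copair C f g) = coprod C (Dom C f) (Dom C g)"
    "Cod C (copair C f g) = Cod C g"
    using u(1) assms(3) by simp_all
qed

declare copair(1-3) [simp]

lemma copair_inl [simp]:
  "f \<in> Arr C \<Longrightarrow> g \<in> Arr C \<Longrightarrow> Cod C f = Cod C g \<Longrightarrow> A = Dom C f \<Longrightarrow> B = Dom C g \<Longrightarrow>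
    copair C f g \<cdot> inl C A B = f"
  using copair(4) by simp

lemma copair_inr [simp]:
  "f \<in> Arr C \<Longrightarrow> g \<in> Arr C \<Longrightarrow> Cod C f = Cod C g \<Longrightarrow> A = Dom C f \<Longrightarrow> B = Dom C g \<Longrightarrow>
    copair C f g \<cdot> inr C A B = g"
  using copair(5) by simp

lemma Comp_copair:
  assumes [simp]: "f \<in> Arr C" "g \<in> Arr C" "Cod C f = Cod C g" "w \<in> Arr C" "Dom C w = Cod C g"
  shows "w \<cdot> copair C f g = copair C (w \<cdot> f) (w \<cdot> g)"
  by (rule coprod_cancel[of "Dom C f" "Dom C g"]) simp_all

lemma copair_Comp_inl:
  assumes "f \<in> Arr C" "g \<in> Arr C" "Cod C f = Cod C g" "A = Dom C f" "B = Dom C g"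
    "x \<in> Arr C" "Cod C x = A"
  shows "copair C f g \<cdot> (inl C A B \<cdot> x) = f \<cdot> x"
  using assms by (intro Comp_eq_extend copair_inl) simp_all

lemma copair_Comp_inr:
  assumes "f \<in> Arr C" "g \<in> Arr C" "Cod C f = Cod C g" "A = Dom C f" "B = Dom C g"
    "x \<in> Arr C" "Cod C x = B"
  shows "copair C f g \<cdot> (inr C A B \<cdot> x) = g \<cdot> x"
  using assms by (intro Comp_eq_extend copair_inr) simp_all

text \<open>The arrows \<open>flat_map\<close>, \<open>flat_unit\<close>, \<open>flat_mult\<close>
  and \<open>action_of_split_extension\<close> are all definite descriptions of this shape with
  \<open>k\<close> a kernel, so for each of them it remains only to exhibit some
  factorization.\<close>

lemma the_factor_through_mono:
  assumes k: "is_mono C k" and "\<exists>u. u \<in> Hom C X (Dom C k) \<and> k \<cdot> u = w"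
  shows "(THE u. u \<in> Hom C X (Dom C k) \<and> k \<cdot> u = w) \<in> Hom C X (Dom C k) \<and>
    k \<cdot> (THE u. u \<in> Hom C X (Dom C k) \<and> k \<cdot> u = w) = w"
proof (rule theI')
  have "u = v" if "u \<in> Hom C X (Dom C k)" "v \<in> Hom C X (Dom C k)" "k \<cdot> u = k \<cdot> v" for u v
    by (rule mono_cancel[OF k]) (use that in simp_all)
  then show "\<exists>!u. u \<in> Hom C X (Dom C k) \<and> k \<cdot> u = w" using assms(2) by metis
qed

section \<open>The kernels \<open>flat C B X\<close> and the structure arrows of their monad\<close>

lemma flat_ker_kernel:
  assumes "B \<in> Obj C" "X \<in> Obj C"
  shows "is_kernel C (copair C (Ide C B) (zero_map C X B)) (flat_ker C B X)"
proof -
  obtain k where "is_kernel C (copair C (Ide C B) (zero_map C X B)) k"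
    by (rule ex_kernel[of "copair C (Ide C B) (zero_map C X B)"]) (use assms in simp_all)
  then show ?thesis unfolding flat_ker_def by (rule someI)
qed

lemma flat_ker_arrow [simp]:
  assumes "B \<in> Obj C" "X \<in> Obj C"
  shows "flat_ker C B X \<in> Arr C" "Dom C (flat_ker C B X) = flat C B X"
    "Cod C (flat_ker C B X) = coprod C B X" "flat C B X \<in> Obj C"
proof -
  show *: "flat_ker C B X \<in> Arr C" "Dom C (flat_ker C B X) = flat C B X"
    "Cod C (flat_ker C B X) = coprod C B X"
    using kernel_arrows(2,3)[OF flat_ker_kernel[OF assms]] assms by (simp_all add: flat_def)
  then show "flat C B X \<in> Obj C" by (metis Dom_in_Obj)
qed

lemma flat_ker_zero:
  assumes "B \<in> Obj C" "X \<in> Obj C"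
  shows "copair C (Ide C B) (zero_map C X B) \<cdot> flat_ker C B X = zero_map C (flat C B X) B"
  using kernel_arrows(4)[OF flat_ker_kernel[OF assms]] assms by simp

lemma flat_ker_factor:
  assumes BX [simp]: "B \<in> Obj C" "X \<in> Obj C"
    and x [simp]: "x \<in> Arr C" "Cod C x = coprod C B X"
    and "copair C (Ide C B) (zero_map C X B) \<cdot> x = zero_map C (Dom C x) B"
  shows "\<exists>u. u \<in> Hom C (Dom C x) (flat C B X) \<and> flat_ker C B X \<cdot> u = x"
proof -
  obtain u where "u \<in> Arr C" "Dom C u = Dom C x" "Cod C u = Dom C (flat_ker C B X)"
    "flat_ker C B X \<cdot> u = x"
    by (rule kernel_factor[OF flat_ker_kernel[OF BX], of x]) (use assms(5) in simp_all)
  then show ?thesis by auto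
qed

lemma flat_map:
  assumes [simp]: "b \<in> Arr C" "x \<in> Arr C"
  shows "flat_map C b x \<in> Hom C (flat C (Dom C b) (Dom C x)) (flat C (Cod C b) (Cod C x)) \<and>
    flat_ker C (Cod C b) (Cod C x) \<cdot> flat_map C b x =
      copair C (inl C (Cod C b) (Cod C x) \<cdot> b) (inr C (Cod C b) (Cod C x) \<cdot> x) \<cdot>
        flat_ker C (Dom C b) (Dom C x)"
proof -
  let ?c = "copair C (inl C (Cod C b) (Cod C x) \<cdot> b) (inr C (Cod C b) (Cod C x) \<cdot> x)"
  have "copair C (Ide C (Cod C b)) (zero_map C (Cod C x) (Cod C b)) \<cdot> ?c =
      b \<cdot> copair C (Ide C (Dom C b)) (zero_map C (Dom C x) (Dom C b))"
    by (simp add: Comp_copair copair_Comp_inl copair_Comp_inr)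
  from Comp_eq_extend[OF this, of "flat_ker C (Dom C b) (Dom C x)"]
  have "copair C (Ide C (Cod C b)) (zero_map C (Cod C x) (Cod C b)) \<cdot>
      (?c \<cdot> flat_ker C (Dom C b) (Dom C x)) = zero_map C (flat C (Dom C b) (Dom C x)) (Cod C b)"
    by (simp add: flat_ker_zero)
  then have ex: "\<exists>u. u \<in> Hom C (flat C (Dom C b) (Dom C x)) (Dom C (flat_ker C (Cod C b) (Cod C x))) \<and>
      flat_ker C (Cod C b) (Cod C x) \<cdot> u = ?c \<cdot> flat_ker C (Dom C b) (Dom C x)"
    using flat_ker_factor[of "Cod C b" "Cod C x" "?c \<cdot> flat_ker C (Dom C b) (Dom C x)"] by simp
  have "is_mono C (flat_ker C (Cod C b) (Cod C x))"
    by (rule kernel_mono[OF flat_ker_kernel]) simp_all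
  from the_factor_through_mono[OF this ex] show ?thesis
    unfolding flat_map_def by simp
qed

lemma flat_map_arrow [simp]:
  assumes "b \<in> Arr C" "x \<in> Arr C"
  shows "flat_map C b x \<in> Arr C" "Dom C (flat_map C b x) = flat C (Dom C b) (Dom C x)"
    "Cod C (flat_map C b x) = flat C (Cod C b) (Cod C x)"
  using flat_map[OF assms] by simp_all

text \<open>Since [s, k] (b + x) = [s b, k x], a composite with \<open>flat_map\<close> can be
  computed on the coproduct. This is how the action equations below are evaluated once they have
  been composed with the kernel \<open>k\<close>.\<close>

lemma copair_flat_map:
  assumes [simp]: "b \<in> Arr C" "x \<in> Arr C" "s \<in> Arr C" "k \<in> Arr C" "Cod C s = Cod C k"
    "B = Cod C b" "X = Cod C x" "Dom C s = Cod C b" "Dom C k = Cod C x"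
  shows "copair C s k \<cdot> (flat_ker C B X \<cdot> flat_map C b x) =
    copair C (s \<cdot> b) (k \<cdot> x) \<cdot> flat_ker C (Dom C b) (Dom C x)"
proof -
  have "copair C s k \<cdot> copair C (inl C (Cod C b) (Cod C x) \<cdot> b) (inr C (Cod C b) (Cod C x) \<cdot> x) =
      copair C (s \<cdot> b) (k \<cdot> x)"
    by (simp add: Comp_copair copair_Comp_inl copair_Comp_inr)
  from Comp_eq_extend[OF this, of "flat_ker C (Dom C b) (Dom C x)"] show ?thesis
    using flat_map[of b x] by simp
qed

lemma flat_unit:
  assumes [simp]: "B \<in> Obj C" "X \<in> Obj C"
  shows "flat_unit C B X \<in> Hom C X (flat C B X) \<and> flat_ker C B X \<cdot> flat_unit C B X = inr C B X"
proof -
  have ex: "\<exists>u. u \<in> Hom C X (Dom C (flat_ker C B X)) \<and> flat_ker C B X \<cdot> u = inr C B X"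
    using flat_ker_factor[of B X "inr C B X"] by simp
  have "is_mono C (flat_ker C B X)"
    by (rule kernel_mono[OF flat_ker_kernel]) simp_all
  from the_factor_through_mono[OF this ex] show ?thesis
    unfolding flat_unit_def by simp
qed

lemma flat_mult:
  assumes [simp]: "B \<in> Obj C" "X \<in> Obj C"
  shows "flat_mult C B X \<in> Hom C (flat C B (flat C B X)) (flat C B X) \<and>
    flat_ker C B X \<cdot> flat_mult C B X =
      copair C (inl C B X) (flat_ker C B X) \<cdot> flat_ker C B (flat C B X)"
proof -
  let ?c = "copair C (inl C B X) (flat_ker C B X)"
  have "copair C (Ide C B) (zero_map C X B) \<cdot> ?c = copair C (Ide C B) (zero_map C (flat C B X) B)"
    by (simp add: Comp_copair flat_ker_zero)
  from Comp_eq_extend[OF this, of "flat_ker C B (flat C B X)"]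
  have "copair C (Ide C B) (zero_map C X B) \<cdot> (?c \<cdot> flat_ker C B (flat C B X)) =
      zero_map C (flat C B (flat C B X)) B"
    by (simp add: flat_ker_zero)
  then have ex: "\<exists>u. u \<in> Hom C (flat C B (flat C B X)) (Dom C (flat_ker C B X)) \<and>
      flat_ker C B X \<cdot> u = ?c \<cdot> flat_ker C B (flat C B X)"
    using flat_ker_factor[of B X "?c \<cdot> flat_ker C B (flat C B X)"] by simp
  have "is_mono C (flat_ker C B X)"
    by (rule kernel_mono[OF flat_ker_kernel]) simp_all
  from the_factor_through_mono[OF this ex] show ?thesis
    unfolding flat_mult_def by simp
qed

section \<open>The action determined by a split extension\<close>

lemma action_of_split_extension:
  assumes ext: "is_split_extension C X B k p s"
  shows "action_of_split_extension C k p s \<in> Hom C (flat C B X) X"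
    and "k \<cdot> action_of_split_extension C k p s = copair C s k \<cdot> flat_ker C B X"
proof -
  note [simp] = split_extension_arrows(1-10,12,13)[OF ext]
  note ker = split_extension_arrows(11)[OF ext]
  have "p \<cdot> copair C s k = copair C (Ide C B) (zero_map C X B)"
    by (simp add: Comp_copair)
  from Comp_eq_extend[OF this, of "flat_ker C B X"]
  have "p \<cdot> (copair C s k \<cdot> flat_ker C B X) = zero_map C (flat C B X) B"
    by (simp add: flat_ker_zero)
  then obtain u where "u \<in> Arr C" "Dom C u = flat C B X" "Cod C u = X" "k \<cdot> u = copair C s k \<cdot> flat_ker C B X"
    using kernel_factor[OF ker, of "copair C s k \<cdot> flat_ker C B X"] by auto
  then have ex: "\<exists>u. u \<in> Hom C (flat C B X) (Dom C k) \<and> k \<cdot> u = copair C s k \<cdot> flat_ker C B X"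
    by auto
  from the_factor_through_mono[OF kernel_mono[OF ker] ex]
  show "action_of_split_extension C k p s \<in> Hom C (flat C B X) X"
    "k \<cdot> action_of_split_extension C k p s = copair C s k \<cdot> flat_ker C B X"
    unfolding action_of_split_extension_def by simp_all
qed

lemma action_of_split_extension_unique:
  assumes ext: "is_split_extension C X B k p s" and "\<xi> \<in> Hom C (flat C B X) X"
    and "k \<cdot> \<xi> = copair C s k \<cdot> flat_ker C B X"
  shows "\<xi> = action_of_split_extension C k p s"
  by (rule mono_cancel[OF kernel_mono[OF split_extension_arrows(11)[OF ext]]])
    (use assms(2,3) action_of_split_extension[OF ext] split_extension_arrows(7)[OF ext] in simp_all)

text \<open>Both algebra laws can be tested after composing with the monomorphism \<open>k\<close>.
  For the multiplication law the two sides then become the same arrow [s, k \<xi>] restricted to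
  \<open>flat_ker C B (flat C B X)\<close>.\<close>

lemma action_of_split_extension_is_action:
  assumes ext: "is_split_extension C X B k p s"
  shows "is_action C B X (action_of_split_extension C k p s)"
proof -
  let ?\<xi> = "action_of_split_extension C k p s"
  note [simp] = split_extension_arrows(1-10,12,13)[OF ext]
  note mono = kernel_mono[OF split_extension_arrows(11)[OF ext]]
  have [simp]: "?\<xi> \<in> Arr C" "Dom C ?\<xi> = flat C B X" "Cod C ?\<xi> = X"
    and k\<xi>: "k \<cdot> ?\<xi> = copair C s k \<cdot> flat_ker C B X"
    using action_of_split_extension[OF ext] by simp_all
  have [simp]: "flat_unit C B X \<in> Arr C" "Dom C (flat_unit C B X) = X" "Cod C (flat_unit C B X) = flat C B X"
    and unit: "flat_ker C B X \<cdot> flat_unit C B X = inr C B X"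
    using flat_unit[of B X] by simp_all
  have [simp]: "flat_mult C B X \<in> Arr C" "Dom C (flat_mult C B X) = flat C B (flat C B X)"
      "Cod C (flat_mult C B X) = flat C B X"
    and mult: "flat_ker C B X \<cdot> flat_mult C B X =
      copair C (inl C B X) (flat_ker C B X) \<cdot> flat_ker C B (flat C B X)"
    using flat_mult[of B X] by simp_all
  have "?\<xi> \<cdot> flat_unit C B X = Ide C X"
    by (rule mono_cancel[OF mono]) (simp_all add: Comp_eq_extend[OF k\<xi>] unit Ide_right)
  moreover have "?\<xi> \<cdot> flat_mult C B X = ?\<xi> \<cdot> flat_map C (Ide C B) ?\<xi>"
  proof (rule mono_cancel[OF mono])
    have "copair C s k \<cdot> copair C (inl C B X) (flat_ker C B X) = copair C s (k \<cdot> ?\<xi>)"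
      by (simp add: Comp_copair k\<xi>)
    from Comp_eq_extend[OF this, of "flat_ker C B (flat C B X)"]
    have "k \<cdot> (?\<xi> \<cdot> flat_mult C B X) = copair C s (k \<cdot> ?\<xi>) \<cdot> flat_ker C B (flat C B X)"
      by (simp add: Comp_eq_extend[OF k\<xi>] mult)
    moreover have "k \<cdot> (?\<xi> \<cdot> flat_map C (Ide C B) ?\<xi>) = copair C s (k \<cdot> ?\<xi>) \<cdot> flat_ker C B (flat C B X)"
      by (simp add: Comp_eq_extend[OF k\<xi>] copair_flat_map)
    ultimately show "k \<cdot> (?\<xi> \<cdot> flat_mult C B X) = k \<cdot> (?\<xi> \<cdot> flat_map C (Ide C B) ?\<xi>)" by simp
  qed simp_all
  ultimately show ?thesis by (simp add: is_action_def)
qed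

text \<open>Composed with \<open>k\<close>, both sides become
  \<open>copair C (s \<cdot> \<phi>) k \<cdot> flat_ker C B' X\<close>. When the target is a
  classifier, this turns the classifying arrow into the equation between actions asked for in part
  (ii).\<close>

lemma action_of_split_extension_natural:
  assumes ext: "is_split_extension C X B k p s" and ext': "is_split_extension C X B' k' p' s'"
    and mor: "is_split_extension_morphism C (k', p', s') (k, p, s) (Ide C X) \<phi>1 \<phi>"
  shows "action_of_split_extension C k p s \<cdot> flat_map C \<phi> (Ide C X) = action_of_split_extension C k' p' s'"
proof (rule mono_cancel[OF kernel_mono[OF split_extension_arrows(11)[OF ext]]])
  note [simp] = split_extension_arrows(1-10,12,13)[OF ext] split_extension_arrows(1-10,12,13)[OF ext']
  have [simp]: "\<phi>1 \<in> Arr C" "Dom C \<phi>1 = Dom C p'" "Cod C \<phi>1 = Dom C p"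
      "\<phi> \<in> Arr C" "Dom C \<phi> = B'" "Cod C \<phi> = B"
    and eqs: "\<phi>1 \<cdot> k' = k" "\<phi>1 \<cdot> s' = s \<cdot> \<phi>"
    using mor by (auto simp: is_split_extension_morphism_def Ide_right)
  note [simp] = action_of_split_extension(1)[OF ext, simplified]
    action_of_split_extension(1)[OF ext', simplified]
  note act = action_of_split_extension(2)[OF ext] action_of_split_extension(2)[OF ext']
  have "\<phi>1 \<cdot> copair C s' k' = copair C (s \<cdot> \<phi>) k" by (simp add: Comp_copair eqs)
  from Comp_eq_extend[OF this, of "flat_ker C B' X"]
  have "\<phi>1 \<cdot> (k' \<cdot> action_of_split_extension C k' p' s') = copair C (s \<cdot> \<phi>) k \<cdot> flat_ker C B' X"
    by (simp add: act)
  then have "k \<cdot> action_of_split_extension C k' p' s' = copair C (s \<cdot> \<phi>) k \<cdot> flat_ker C B' X"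
    by (simp add: Comp_eq_extend[OF eqs(1)])
  moreover have "k \<cdot> (action_of_split_extension C k p s \<cdot> flat_map C \<phi> (Ide C X)) =
      copair C (s \<cdot> \<phi>) k \<cdot> flat_ker C B' X"
    by (simp add: Comp_eq_extend[OF act(1)] copair_flat_map Ide_right)
  ultimately show "k \<cdot> (action_of_split_extension C k p s \<cdot> flat_map C \<phi> (Ide C X)) =
      k \<cdot> action_of_split_extension C k' p' s'" by simp
  show "action_of_split_extension C k p s \<cdot> flat_map C \<phi> (Ide C X) \<in> Arr C"
    "action_of_split_extension C k' p' s' \<in> Arr C"
    "Cod C (action_of_split_extension C k p s \<cdot> flat_map C \<phi> (Ide C X)) = Dom C k"
    "Cod C (action_of_split_extension C k' p' s') = Dom C k" by simp_all
qed

section \<open>Restricting and dividing split extensions\<close>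

text \<open>
  The total object of the restricted split extension is the image of \<open>[s, k h] : B + H \<rightarrow> A\<close>.
  Its kernel is no larger than \<open>H\<close> because \<open>k h \<xi>' = [s, k h] ker [1, 0]\<close>.
\<close>

lemma restricted_split_extension:
  assumes ext: "is_split_extension C G B k p s" and h: "h \<in> Hom C H G" and mono: "is_mono C h"
    and res: "is_restricted_action C h B (action_of_split_extension C k p s) \<xi>"
  obtains m n p' s' where "is_split_extension C H B n p' s'" "is_mono C m" "Dom C m = Dom C p'"
    "Cod C m = Dom C p" "p \<cdot> m = p'" "m \<cdot> s' = s" "m \<cdot> n = k \<cdot> h"
    "action_of_split_extension C n p' s' = \<xi>"
proof -
  note [simp] = split_extension_arrows(1-10,12,13)[OF ext]
  note ker = split_extension_arrows(11)[OF ext]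
  have [simp]: "h \<in> Arr C" "Dom C h = H" "Cod C h = G" using h by simp_all
  then have [simp]: "H \<in> Obj C" using Dom_in_Obj by blast
  note [simp] = action_of_split_extension(1)[OF ext, simplified]
  have [simp]: "\<xi> \<in> Arr C" "Dom C \<xi> = flat C B H" "Cod C \<xi> = H"
    and h\<xi>: "h \<cdot> \<xi> = action_of_split_extension C k p s \<cdot> flat_map C (Ide C B) h"
    using res by (auto simp: is_restricted_action_def is_action_def)
  define c where "c = copair C s (k \<cdot> h)"
  have c [simp]: "c \<in> Arr C" "Dom C c = coprod C B H" "Cod C c = Dom C p"
    "c \<cdot> inl C B H = s" "c \<cdot> inr C B H = k \<cdot> h"
    by (simp_all add: c_def)
  have kh\<xi>: "k \<cdot> (h \<cdot> \<xi>) = c \<cdot> flat_ker C B H"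
    by (simp add: h\<xi> Comp_eq_extend[OF action_of_split_extension(2)[OF ext]] copair_flat_map c_def Ide_right)
  have pc: "p \<cdot> c = copair C (Ide C B) (zero_map C H B)"
    by (simp add: c_def Comp_copair Comp_eq_extend[OF split_extension_arrows(10)[OF ext]])
  obtain e m where e: "is_regular_epi C e" and m: "is_mono C m"
    and [simp]: "Dom C e = coprod C B H" "Cod C e = Dom C m" "Cod C m = Dom C p" and me: "m \<cdot> e = c"
    by (rule image_factorization[of c]) simp_all
  note [simp] = mono_arrow[OF m] regular_epi_arrow[OF e]
  define n where "n = e \<cdot> inr C B H"
  define s' where "s' = e \<cdot> inl C B H"
  have [simp]: "n \<in> Arr C" "Dom C n = H" "Cod C n = Dom C m"
    "s' \<in> Arr C" "Dom C s' = B" "Cod C s' = Dom C m"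
    by (simp_all add: n_def s'_def)
  have mn: "m \<cdot> n = k \<cdot> h" and ms: "m \<cdot> s' = s"
    by (simp_all add: n_def s'_def Comp_eq_extend[OF me])
  have "is_kernel C (p \<cdot> m) n"
  proof (rule kernelI)
    show "is_mono C n"
    proof (rule monoI)
      fix f g
      assume [simp]: "f \<in> Arr C" "g \<in> Arr C" "Cod C f = Dom C n" "Cod C g = Dom C n" "Dom C f = Dom C g"
        and eq: "n \<cdot> f = n \<cdot> g"
      have "k \<cdot> (h \<cdot> f) = k \<cdot> (h \<cdot> g)"
        using Comp_eq_extend[OF mn, of f] Comp_eq_extend[OF mn, of g] by (simp add: eq)
      then have "h \<cdot> f = h \<cdot> g"
        by (intro mono_cancel[OF kernel_mono[OF ker], of "h \<cdot> f" "h \<cdot> g"]) simp_all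
      then show "f = g" by (intro mono_cancel[OF mono, of f g]) simp_all
    qed simp
    show "(p \<cdot> m) \<cdot> n = zero_map C (Dom C n) (Cod C (p \<cdot> m))"
      by (simp add: mn Comp_eq_extend[OF split_extension_arrows(10)[OF ext]])
    fix x
    assume [simp]: "x \<in> Arr C" "Cod C x = Dom C (p \<cdot> m)"
      and "(p \<cdot> m) \<cdot> x = zero_map C (Dom C x) (Cod C (p \<cdot> m))"
    then have pmx: "p \<cdot> (m \<cdot> x) = zero_map C (Dom C x) B" by simp
    obtain y where [simp]: "y \<in> Arr C" "Dom C y = Dom C x" "Cod C y = G" and ky: "k \<cdot> y = m \<cdot> x"
      using kernel_factor[OF ker, of "m \<cdot> x"] pmx by auto
    \<comment> \<open>The element \<open>x\<close> of the kernel lifts along \<open>e\<close> only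
      over the cover \<open>e1\<close>. The lift \<open>x1\<close> into B + H is annihilated by
      [1, 0], so it factors through \<open>flat C B H\<close>, where \<xi> is defined and sends it
      into H.\<close>
    obtain x1 e1 where pb: "is_pullback C e x x1 e1" by (rule ex_pullback[of e x]) simp_all
    note [simp] = pullback_arrows(3,4,6-8)[OF pb]
    note ex1 = pullback_arrows(9)[OF pb]
    have cx1: "c \<cdot> x1 = m \<cdot> (x \<cdot> e1)"
      using Comp_eq_extend[OF me, of x1] by (simp add: ex1)
    have "p \<cdot> (m \<cdot> (x \<cdot> e1)) = zero_map C (Dom C x1) B"
      using Comp_eq_extend[OF pmx, of e1] by simp
    then have "copair C (Ide C B) (zero_map C H B) \<cdot> x1 = zero_map C (Dom C x1) B"
      using Comp_eq_extend[OF pc, of x1] by (simp add: cx1)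
    then obtain w where [simp]: "w \<in> Arr C" "Dom C w = Dom C x1" "Cod C w = flat C B H"
      and w: "flat_ker C B H \<cdot> w = x1"
      using flat_ker_factor[of B H x1] by auto
    have "k \<cdot> (h \<cdot> (\<xi> \<cdot> w)) = c \<cdot> x1"
      using Comp_eq_extend[OF kh\<xi>, of w] by (simp add: w)
    then have "k \<cdot> (h \<cdot> (\<xi> \<cdot> w)) = k \<cdot> (y \<cdot> e1)"
      using Comp_eq_extend[OF ky, of e1] by (simp add: cx1)
    then have h\<xi>w: "h \<cdot> (\<xi> \<cdot> w) = y \<cdot> e1"
      by (intro mono_cancel[OF kernel_mono[OF ker], of "h \<cdot> (\<xi> \<cdot> w)" "y \<cdot> e1"]) simp_all
    \<comment> \<open>Over the cover \<open>e1\<close> the element \<open>y\<close> of G lies in H;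
      since \<open>h\<close> is monic and \<open>e1\<close> a regular epimorphism, \<open>y\<close>
      itself lies in H.\<close>
    obtain v where [simp]: "v \<in> Arr C" "Dom C v = Dom C x" "Cod C v = H" and hv: "h \<cdot> v = y"
      by (rule regular_epi_lift[OF regular_epi_pullback[OF pb e] mono _ _ _ _ _ _ h\<xi>w]) simp_all
    have "n \<cdot> v = x"
      by (rule mono_cancel[OF m]) (simp_all add: Comp_eq_extend[OF mn] hv ky)
    then show "\<exists>u. u \<in> Arr C \<and> Dom C u = Dom C x \<and> Cod C u = Dom C n \<and> n \<cdot> u = x"
      by (intro exI[of _ v]) simp
  qed simp_all
  then have ext': "is_split_extension C H B n (p \<cdot> m) s'"
    by (simp add: is_split_extension_def is_point_def ms)
  have "m \<cdot> copair C s' n = c" by (simp add: c_def Comp_copair ms mn)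
  from Comp_eq_extend[OF this, of "flat_ker C B H"]
  have "m \<cdot> (copair C s' n \<cdot> flat_ker C B H) = m \<cdot> (n \<cdot> \<xi>)"
    by (simp add: Comp_eq_extend[OF mn] kh\<xi>)
  then have "n \<cdot> \<xi> = copair C s' n \<cdot> flat_ker C B H"
    by (intro mono_cancel[OF m, of "n \<cdot> \<xi>"]) simp_all
  then have "\<xi> = action_of_split_extension C n (p \<cdot> m) s'"
    by (intro action_of_split_extension_unique[OF ext']) simp_all
  then show thesis
    by (intro that[OF ext' m]) (simp_all add: ms mn)
qed

lemma characteristic_restricted:
  assumes "characteristic C h" "B \<in> Obj C" "is_action C B (Cod C h) \<xi>"
  shows "is_restricted_action C h B \<xi> (restrict_action C h B \<xi>)"
  unfolding restrict_action_def
  by (rule theI') (use assms in \<open>simp add: characteristic_def\<close>)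

section \<open>Cokernels and the normality of regular epimorphisms\<close>

lemma cokernel_arrows:
  assumes "is_cokernel C h q"
  shows "h \<in> Arr C" "q \<in> Arr C" "Dom C q = Cod C h" "q \<cdot> h = zero_map C (Dom C h) (Cod C q)"
  using assms unfolding is_cokernel_def Hom_iff by blast+

lemma cokernel_factor:
  assumes "is_cokernel C h q" "x \<in> Arr C" "Dom C x = Cod C h" "x \<cdot> h = zero_map C (Dom C h) (Cod C x)"
  shows "\<exists>!u. u \<in> Hom C (Cod C q) (Cod C x) \<and> u \<cdot> q = x"
proof -
  have "x \<in> Hom C (Cod C h) (Cod C x)" using assms by simp
  then show ?thesis using assms unfolding is_cokernel_def by blast
qed

text \<open>The kernel pair of \<open>t\<close>, split by the diagonal \<open>d\<close>, has kernel
  (0, h). If \<open>x\<close> annihilates \<open>h\<close>, then \<open>x \<cdot> a\<close> and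
  \<open>x \<cdot> b\<close> agree on the diagonal and on this kernel, hence everywhere, so
  \<open>x\<close> identifies whatever \<open>t\<close> identifies.\<close>

lemma regular_epi_cokernel_of_kernel:
  assumes t: "is_regular_epi C t" and h: "is_kernel C t h"
  shows "is_cokernel C h t"
proof -
  note [simp] = regular_epi_arrow[OF t] kernel_arrows(2-4)[OF h]
  have "\<exists>u. u \<in> Hom C (Cod C t) (Cod C x) \<and> u \<cdot> t = x"
    if [simp]: "x \<in> Arr C" "Dom C x = Dom C t" and xh: "x \<cdot> h = zero_map C (Dom C h) (Cod C x)" for x
  proof -
    obtain a b where pb: "is_pullback C t t a b" by (rule ex_pullback[of t t]) simp_all
    note [simp] = pullback_arrows(3,4,6-8)[OF pb]
    note tab = pullback_arrows(9)[OF pb]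
    obtain d where [simp]: "d \<in> Arr C" "Dom C d = Dom C t" "Cod C d = Dom C a"
      and d: "a \<cdot> d = Ide C (Dom C t)" "b \<cdot> d = Ide C (Dom C t)"
      by (rule pullback_factor[OF pb, of "Ide C (Dom C t)" "Ide C (Dom C t)"]) simp_all
    obtain k where [simp]: "k \<in> Arr C" "Dom C k = Dom C h" "Cod C k = Dom C a"
      and ak: "a \<cdot> k = zero_map C (Dom C h) (Dom C t)" and bk: "b \<cdot> k = h"
      by (rule pullback_factor[OF pb, of "zero_map C (Dom C h) (Dom C t)" h]) simp_all
    have "is_kernel C a k"
    proof (rule kernelI)
      show "is_mono C k"
      proof (rule monoI)
        fix f g
        assume [simp]: "f \<in> Arr C" "g \<in> Arr C" "Cod C f = Dom C k" "Cod C g = Dom C k"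
          "Dom C f = Dom C g" and eq: "k \<cdot> f = k \<cdot> g"
        have "h \<cdot> f = h \<cdot> g"
          using Comp_eq_extend[OF bk, of f] Comp_eq_extend[OF bk, of g] by (simp add: eq)
        then show "f = g" by (intro mono_cancel[OF kernel_mono[OF h], of f g]) simp_all
      qed simp
      fix y
      assume [simp]: "y \<in> Arr C" "Cod C y = Dom C a" and ay: "a \<cdot> y = zero_map C (Dom C y) (Cod C a)"
      have "t \<cdot> (b \<cdot> y) = zero_map C (Dom C y) (Cod C t)"
        using Comp_eq_extend[OF tab, of y] by (simp add: ay)
      then obtain u where [simp]: "u \<in> Arr C" "Dom C u = Dom C y" "Cod C u = Dom C h"
        and hu: "h \<cdot> u = b \<cdot> y"
        using kernel_factor[OF h, of "b \<cdot> y"] by auto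
      have "k \<cdot> u = y"
        by (rule pullback_cancel[OF pb])
          (simp_all add: Comp_eq_extend[OF ak] Comp_eq_extend[OF bk] hu ay)
      then show "\<exists>u. u \<in> Arr C \<and> Dom C u = Dom C y \<and> Cod C u = Dom C k \<and> k \<cdot> u = y"
        by (intro exI[of _ u]) simp
    qed (simp_all add: ak)
    then have ext: "is_split_extension C (Dom C h) (Dom C t) k a d"
      by (simp add: is_split_extension_def is_point_def d)
    have xab: "x \<cdot> a = x \<cdot> b"
      by (rule split_extension_jointly_epic[OF ext]) (simp_all add: d ak bk xh)
    \<comment> \<open>The pair that \<open>t\<close> is known to coequalize need not be its kernel
      pair, but it factors through the kernel pair, where \<open>x\<close> has just been seen to
      identify both legs.\<close>
    obtain f g where fg: "is_coequalizer C f g t" using t by (auto simp: is_regular_epi_def)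
    have [simp]: "f \<in> Arr C" "g \<in> Arr C" "Dom C g = Dom C f" "Cod C f = Dom C t" "Cod C g = Dom C t"
      using coequalizer_arrows[OF fg] by simp_all
    obtain v where [simp]: "v \<in> Arr C" "Cod C v = Dom C a" and v: "a \<cdot> v = f" "b \<cdot> v = g"
      by (rule pullback_factor[OF pb, of f g]) (simp_all add: coequalizer_arrows(7)[OF fg])
    have "x \<cdot> f = x \<cdot> g" using Comp_eq_extend[OF xab, of v] by (simp add: v)
    then obtain u where "u \<in> Arr C" "Dom C u = Cod C t" "Cod C u = Cod C x" "u \<cdot> t = x"
      using coequalizer_factor[OF fg, of x] by auto
    then show ?thesis by auto
  qed
  moreover have "u = v" if "u \<in> Hom C (Cod C t) X" "v \<in> Hom C (Cod C t) X" "u \<cdot> t = v \<cdot> t" for u v X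
    by (rule regular_epi_cancel[OF t]) (use that in simp_all)
  ultimately have "\<exists>!u. u \<in> Hom C (Cod C t) X \<and> u \<cdot> t = x"
    if "x \<in> Hom C (Dom C t) X" "x \<cdot> h = zero_map C (Dom C h) X" for x X
    using that by (metis (no_types, lifting) Hom_iff)
  then show ?thesis by (simp add: is_cokernel_def)
qed

text \<open>The division below produces a cokernel \<open>t\<close> of its own; the isomorphism
  serves to move the resulting split extension to the prescribed quotient object.\<close>

lemma cokernel_unique:
  assumes q: "is_cokernel C h q" and t: "is_cokernel C h t"
  obtains i j where "i \<in> Hom C (Cod C q) (Cod C t)" "j \<in> Hom C (Cod C t) (Cod C q)" "i \<cdot> q = t"
    "i \<cdot> j = Ide C (Cod C t)" "j \<cdot> i = Ide C (Cod C q)"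
proof -
  note [simp] = cokernel_arrows[OF q] cokernel_arrows[OF t]
  have retract: "j \<cdot> i = Ide C (Cod C q)"
    if "is_cokernel C h q" and [simp]: "i \<in> Hom C (Cod C q) (Cod C t)" "j \<in> Hom C (Cod C t) (Cod C q)"
      and ij: "i \<cdot> q = t" "j \<cdot> t = q" for q t i j
  proof -
    note [simp] = cokernel_arrows[OF that(1)] that(2,3)[simplified]
    have "\<exists>!u. u \<in> Hom C (Cod C q) (Cod C q) \<and> u \<cdot> q = q"
      by (rule cokernel_factor[OF that(1)]) simp_all
    moreover have "j \<cdot> i \<in> Hom C (Cod C q) (Cod C q) \<and> (j \<cdot> i) \<cdot> q = q" by (simp add: ij)
    moreover have "Ide C (Cod C q) \<in> Hom C (Cod C q) (Cod C q) \<and> Ide C (Cod C q) \<cdot> q = q" by simp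
    ultimately show ?thesis by blast
  qed
  obtain i where i: "i \<in> Hom C (Cod C q) (Cod C t)" "i \<cdot> q = t"
    using cokernel_factor[OF q, of t] by auto
  obtain j where j: "j \<in> Hom C (Cod C t) (Cod C q)" "j \<cdot> t = q"
    using cokernel_factor[OF t, of q] by auto
  show thesis
    by (rule that[OF i(1) j(1) i(2) retract[OF t j(1) i(1) j(2) i(2)] retract[OF q i(1) j(1) i(2) j(2)]])
qed

text \<open>
  Restricting the action of \<open>A\<close> on \<open>G\<close> that belongs to the kernel pair of \<open>p\<close> yields a reflexive
  relation on \<open>A\<close> whose zero class is \<open>k h\<close>; the quotient of \<open>A\<close> by it is the total object.
\<close>

lemma characteristic_quotient:
  assumes ext: "is_split_extension C G B k p s" and h: "h \<in> Hom C H G" and char: "characteristic C h"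
    and q: "is_cokernel C h q"
  obtains k' p' s' e where "is_split_extension C (Cod C q) B k' p' s'"
    "is_split_extension_morphism C (k, p, s) (k', p', s') q e (Ide C B)"
proof -
  note [simp] = split_extension_arrows(1-10,12,13)[OF ext] cokernel_arrows[OF q]
  note ker = split_extension_arrows(11)[OF ext]
  have mono: "is_mono C h" using char by (simp add: characteristic_def)
  have [simp]: "Dom C h = H" "Cod C h = G" using h by simp_all
  then have [simp]: "H \<in> Obj C" using Dom_in_Obj cokernel_arrows(1)[OF q] by blast
  obtain a b where pb: "is_pullback C p p a b" by (rule ex_pullback[of p p]) simp_all
  note [simp] = pullback_arrows(3,4,6-8)[OF pb]
  note pab = pullback_arrows(9)[OF pb]
  obtain \<delta> where [simp]: "\<delta> \<in> Arr C" "Dom C \<delta> = Dom C p" "Cod C \<delta> = Dom C a"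
    and \<delta>: "a \<cdot> \<delta> = Ide C (Dom C p)" "b \<cdot> \<delta> = Ide C (Dom C p)"
    by (rule pullback_factor[OF pb, of "Ide C (Dom C p)" "Ide C (Dom C p)"]) simp_all
  \<comment> \<open>\<kappa> is the pair (0, k): it embeds G into the kernel pair of
    \<open>p\<close> as the kernel of the first projection \<open>a\<close>, which is split by the
    diagonal \<delta>.\<close>
  obtain \<kappa> where [simp]: "\<kappa> \<in> Arr C" "Dom C \<kappa> = G" "Cod C \<kappa> = Dom C a"
    and a\<kappa>: "a \<cdot> \<kappa> = zero_map C G (Dom C p)" and b\<kappa>: "b \<cdot> \<kappa> = k"
    by (rule pullback_factor[OF pb, of "zero_map C G (Dom C p)" k]) simp_all
  have "is_kernel C a \<kappa>"
  proof (rule kernelI)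
    show "is_mono C \<kappa>"
    proof (rule monoI)
      fix f g
      assume [simp]: "f \<in> Arr C" "g \<in> Arr C" "Cod C f = Dom C \<kappa>" "Cod C g = Dom C \<kappa>"
        "Dom C f = Dom C g" and eq: "\<kappa> \<cdot> f = \<kappa> \<cdot> g"
      have "k \<cdot> f = k \<cdot> g"
        using Comp_eq_extend[OF b\<kappa>, of f] Comp_eq_extend[OF b\<kappa>, of g] by (simp add: eq)
      then show "f = g" by (intro mono_cancel[OF kernel_mono[OF ker], of f g]) simp_all
    qed simp
    fix y
    assume [simp]: "y \<in> Arr C" "Cod C y = Dom C a" and ay: "a \<cdot> y = zero_map C (Dom C y) (Cod C a)"
    have "p \<cdot> (b \<cdot> y) = zero_map C (Dom C y) B"
      using Comp_eq_extend[OF pab, of y] by (simp add: ay)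
    then obtain u where [simp]: "u \<in> Arr C" "Dom C u = Dom C y" "Cod C u = G" and ku: "k \<cdot> u = b \<cdot> y"
      using kernel_factor[OF ker, of "b \<cdot> y"] by auto
    have "\<kappa> \<cdot> u = y"
      by (rule pullback_cancel[OF pb]) (simp_all add: Comp_eq_extend[OF a\<kappa>] Comp_eq_extend[OF b\<kappa>] ku ay)
    then show "\<exists>u. u \<in> Arr C \<and> Dom C u = Dom C y \<and> Cod C u = Dom C \<kappa> \<and> \<kappa> \<cdot> u = y"
      by (intro exI[of _ u]) simp
  qed (simp_all add: a\<kappa>)
  then have ext_pair: "is_split_extension C G (Dom C p) \<kappa> a \<delta>"
    by (simp add: is_split_extension_def is_point_def \<delta>)
  have "is_restricted_action C h (Dom C p) (action_of_split_extension C \<kappa> a \<delta>)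
      (restrict_action C h (Dom C p) (action_of_split_extension C \<kappa> a \<delta>))"
    by (rule characteristic_restricted[OF char])
      (simp_all add: action_of_split_extension_is_action[OF ext_pair])
  then obtain m n r1 d where ext_rel: "is_split_extension C H (Dom C p) n r1 d" and m: "is_mono C m"
    and [simp]: "Dom C m = Dom C r1" "Cod C m = Dom C a" and am: "a \<cdot> m = r1" and md: "m \<cdot> d = \<delta>"
    and mn: "m \<cdot> n = \<kappa> \<cdot> h"
    and "action_of_split_extension C n r1 d =
      restrict_action C h (Dom C p) (action_of_split_extension C \<kappa> a \<delta>)"
    by (rule restricted_split_extension[OF ext_pair h mono])
  note [simp] = split_extension_arrows(1-10)[OF ext_rel] mono_arrow[OF m]
  note ker_rel = split_extension_arrows(11)[OF ext_rel]
  \<comment> \<open>\<open>m\<close> embeds the restricted total object R into the kernel pair of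
    \<open>p\<close>, and (r1, r2) are the two projections of that pair restricted to R. The section
    \<open>d\<close> makes R reflexive, and \<open>n\<close>, being the kernel of \<open>r1\<close>,
    is its zero class.\<close>
  define r2 where "r2 = b \<cdot> m"
  have [simp]: "r2 \<in> Arr C" "Dom C r2 = Dom C r1" "Cod C r2 = Dom C p" by (simp_all add: r2_def)
  have r2n: "r2 \<cdot> n = k \<cdot> h" by (simp add: r2_def mn Comp_eq_extend[OF b\<kappa>])
  have r2d: "r2 \<cdot> d = Ide C (Dom C p)" by (simp add: r2_def md \<delta>)
  have jm: "jointly_monic C r1 r2"
    unfolding jointly_monic_def
  proof (intro conjI allI impI)
    fix X x y
    assume "x \<in> Hom C X (Dom C r1) \<and> y \<in> Hom C X (Dom C r1) \<and> r1 \<cdot> x = r1 \<cdot> y \<and> r2 \<cdot> x = r2 \<cdot> y"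
    then have [simp]: "x \<in> Arr C" "y \<in> Arr C" "Dom C x = X" "Dom C y = X" "Cod C x = Dom C r1"
        "Cod C y = Dom C r1" and eq: "r1 \<cdot> x = r1 \<cdot> y" "r2 \<cdot> x = r2 \<cdot> y"
      by simp_all
    have "m \<cdot> x = m \<cdot> y"
      by (rule pullback_cancel[OF pb]) (use eq in \<open>simp_all add: Comp_eq_extend[OF am] r2_def\<close>)
    then show "x = y" by (intro mono_cancel[OF m, of x y]) simp_all
  qed simp_all
  have "is_equivalence_relation C r1 r2"
    by (rule reflexive_relation_is_equivalence[OF jm, of d]) (simp_all add: r2d)
  then obtain e where coeq: "is_coequalizer C r1 r2 e" and pbe: "is_pullback C e e r1 r2"
    by (rule effective)
  have [simp]: "e \<in> Arr C" "Dom C e = Dom C p" and er: "e \<cdot> r1 = e \<cdot> r2"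
    using coequalizer_arrows[OF coeq] by simp_all
  \<comment> \<open>R lies in the kernel pair of \<open>p\<close>, so \<open>p\<close> descends to
    the quotient by R.\<close>
  have "p \<cdot> r1 = p \<cdot> r2"
    unfolding r2_def by (simp add: am[symmetric] Comp_eq_extend[OF pab])
  then obtain p' where [simp]: "p' \<in> Arr C" "Dom C p' = Cod C e" "Cod C p' = B" and p'e: "p' \<cdot> e = p"
    using coequalizer_factor[OF coeq, of p] by auto
  obtain k' where k': "is_kernel C p' k'" by (rule ex_kernel[of p']) simp_all
  note [simp] = kernel_arrows(2,3)[OF k']
  have p'k': "p' \<cdot> k' = zero_map C (Dom C k') B" using kernel_arrows(4)[OF k'] by simp
  obtain t where [simp]: "t \<in> Arr C" "Dom C t = G" "Cod C t = Dom C k'" and k't: "k' \<cdot> t = e \<cdot> k"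
    using kernel_factor[OF k', of "e \<cdot> k"] by (auto simp: Comp_eq_extend[OF p'e])
  \<comment> \<open>The restriction \<open>t\<close> of \<open>e\<close> to kernels is a pullback of
    \<open>e\<close>, because \<open>e\<close> lies over the identity of B; stability then makes
    \<open>t\<close> a regular epimorphism.\<close>
  have "is_pullback C e k' k t"
  proof (rule pullbackI)
    fix x y
    assume [simp]: "x \<in> Arr C" "y \<in> Arr C" and dom: "Dom C x = Dom C y"
      and [simp]: "Cod C x = Dom C e" "Cod C y = Dom C k'" and exy: "e \<cdot> x = k' \<cdot> y"
    note [simp] = dom
    have "p \<cdot> x = p' \<cdot> (k' \<cdot> y)" using Comp_eq_extend[OF p'e, of x] by (simp add: exy)
    then have "p \<cdot> x = zero_map C (Dom C x) B" by (simp add: Comp_eq_extend[OF p'k'])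
    then obtain u where [simp]: "u \<in> Arr C" "Dom C u = Dom C y" "Cod C u = G" and ku: "k \<cdot> u = x"
      using kernel_factor[OF ker, of x] by auto
    have "t \<cdot> u = y"
      by (rule mono_cancel[OF kernel_mono[OF k']]) (simp_all add: Comp_eq_extend[OF k't] ku exy)
    then show "\<exists>u. u \<in> Arr C \<and> Dom C u = Dom C x \<and> Cod C u = Dom C k \<and> k \<cdot> u = x \<and> t \<cdot> u = y"
      by (intro exI[of _ u]) (simp add: ku)
  next
    fix x y
    assume "x \<in> Arr C" "y \<in> Arr C" "Cod C x = Dom C k" "Cod C y = Dom C k" "k \<cdot> x = k \<cdot> y"
    then show "x = y" by (rule mono_cancel[OF kernel_mono[OF ker]])
  qed (simp_all add: k't)
  moreover have "is_regular_epi C e" using coeq by (auto simp: is_regular_epi_def)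
  ultimately have t: "is_regular_epi C t" by (rule regular_epi_pullback)
  \<comment> \<open>If \<open>t\<close> annihilates \<open>x\<close>, then \<open>e\<close>
    identifies 0 and \<open>k \<cdot> x\<close>, so the pair (0, k x) lies in R. It is then in the
    kernel \<open>n\<close> of \<open>r1\<close>, and comparing second components gives
    \<open>k \<cdot> x\<close> as \<open>k \<cdot> (h \<cdot> v)\<close>.\<close>
  have "is_kernel C t h"
  proof (rule kernelI)
    have "k' \<cdot> (t \<cdot> h) = e \<cdot> (r1 \<cdot> n)"
      using Comp_eq_extend[OF er, of n] by (simp add: Comp_eq_extend[OF k't] r2n)
    then show "t \<cdot> h = zero_map C (Dom C h) (Cod C t)"
      by (intro mono_cancel[OF kernel_mono[OF k'], of "t \<cdot> h"]) simp_all
    fix x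
    assume [simp]: "x \<in> Arr C" "Cod C x = Dom C t" and tx: "t \<cdot> x = zero_map C (Dom C x) (Cod C t)"
    have "e \<cdot> zero_map C (Dom C x) (Dom C p) = e \<cdot> (k \<cdot> x)"
      using Comp_eq_extend[OF k't, of x] by (simp add: tx)
    then obtain w where [simp]: "w \<in> Arr C" "Dom C w = Dom C x" "Cod C w = Dom C r1"
      and r1w: "r1 \<cdot> w = zero_map C (Dom C x) (Dom C p)" and r2w: "r2 \<cdot> w = k \<cdot> x"
      using pullback_factor[OF pbe, of "zero_map C (Dom C x) (Dom C p)" "k \<cdot> x"] by auto
    obtain v where [simp]: "v \<in> Arr C" "Dom C v = Dom C x" "Cod C v = H" and nv: "n \<cdot> v = w"
      using kernel_factor[OF ker_rel, of w] r1w by auto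
    have "h \<cdot> v = x"
      by (rule mono_cancel[OF kernel_mono[OF ker]])
        (use Comp_eq_extend[OF r2n, of v] in \<open>simp_all add: nv r2w\<close>)
    then show "\<exists>u. u \<in> Arr C \<and> Dom C u = Dom C x \<and> Cod C u = Dom C h \<and> h \<cdot> u = x"
      by (intro exI[of _ v]) simp
  qed (simp_all add: mono)
  then have "is_cokernel C h t" by (rule regular_epi_cokernel_of_kernel[OF t])
  then obtain i j where "i \<in> Hom C (Cod C q) (Cod C t)" "j \<in> Hom C (Cod C t) (Cod C q)"
    and iq: "i \<cdot> q = t" and ij: "i \<cdot> j = Ide C (Cod C t)" and ji: "j \<cdot> i = Ide C (Cod C q)"
    by (rule cokernel_unique[OF q])
  then have [simp]: "i \<in> Arr C" "Dom C i = Cod C q" "Cod C i = Dom C k'"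
      "j \<in> Arr C" "Dom C j = Dom C k'" "Cod C j = Cod C q"
    by simp_all
  \<comment> \<open>The kernel of \<open>p'\<close> is reindexed along the isomorphism
    \<open>i\<close>, so that its domain is \<open>Cod C q\<close> and the induced arrow on kernels
    is \<open>q\<close> instead of \<open>t\<close>.\<close>
  have "is_kernel C p' (k' \<cdot> i)"
  proof (rule kernelI)
    show "is_mono C (k' \<cdot> i)"
    proof (rule monoI)
      fix f g
      assume [simp]: "f \<in> Arr C" "g \<in> Arr C" "Cod C f = Dom C (k' \<cdot> i)" "Cod C g = Dom C (k' \<cdot> i)"
        "Dom C f = Dom C g" and eq: "(k' \<cdot> i) \<cdot> f = (k' \<cdot> i) \<cdot> g"
      have i: "i \<cdot> f = i \<cdot> g"
        by (rule mono_cancel[OF kernel_mono[OF k']]) (use eq in simp_all)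
      have "f = j \<cdot> (i \<cdot> f)" by (simp add: Comp_eq_extend[OF ji])
      also have "\<dots> = g" by (simp add: i Comp_eq_extend[OF ji])
      finally show "f = g" .
    qed simp
    fix x
    assume x: "x \<in> Arr C" "Cod C x = Dom C p'" "p' \<cdot> x = zero_map C (Dom C x) (Cod C p')"
    obtain u where "u \<in> Arr C" "Dom C u = Dom C x" "Cod C u = Dom C k'" "k' \<cdot> u = x"
      by (rule kernel_factor[OF k' x])
    then show "\<exists>u. u \<in> Arr C \<and> Dom C u = Dom C x \<and> Cod C u = Dom C (k' \<cdot> i) \<and> (k' \<cdot> i) \<cdot> u = x"
      by (intro exI[of _ "j \<cdot> u"]) (simp add: Comp_eq_extend[OF ij])
  qed (simp_all add: Comp_eq_extend[OF p'k'])
  then have "is_split_extension C (Cod C q) B (k' \<cdot> i) p' (e \<cdot> s)"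
    by (simp add: is_split_extension_def is_point_def Comp_eq_extend[OF p'e])
  moreover have "is_split_extension_morphism C (k, p, s) (k' \<cdot> i, p', e \<cdot> s) q e (Ide C B)"
    by (simp add: is_split_extension_morphism_def iq k't p'e Ide_right)
  ultimately show thesis by (rule that)
qed

section \<open>Composition of morphisms and arrows into classifiers\<close>

lemma split_extension_morphism_compose:
  assumes f: "is_split_extension_morphism C (k, p, s) (k', p', s') x f\<^sub>1 f"
    and g: "is_split_extension_morphism C (k', p', s') (k'', p'', s'') y g\<^sub>1 g"
    and [simp]: "k \<in> Arr C" "p \<in> Arr C" "s \<in> Arr C" "k' \<in> Arr C" "p' \<in> Arr C" "s' \<in> Arr C"
      "k'' \<in> Arr C" "p'' \<in> Arr C" "s'' \<in> Arr C" "Cod C k = Dom C p" "Cod C s = Dom C p" "Dom C s = Cod C p"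
      "Cod C k' = Dom C p'" "Cod C s' = Dom C p'" "Dom C s' = Cod C p'"
      "Cod C k'' = Dom C p''" "Cod C s'' = Dom C p''" "Dom C s'' = Cod C p''"
  shows "is_split_extension_morphism C (k, p, s) (k'', p'', s'') (y \<cdot> x) (g\<^sub>1 \<cdot> f\<^sub>1) (g \<cdot> f)"
proof -
  have [simp]: "x \<in> Arr C" "Dom C x = Dom C k" "Cod C x = Dom C k'"
      "f\<^sub>1 \<in> Arr C" "Dom C f\<^sub>1 = Dom C p" "Cod C f\<^sub>1 = Dom C p'"
      "f \<in> Arr C" "Dom C f = Cod C p" "Cod C f = Cod C p'"
    and F: "f\<^sub>1 \<cdot> k = k' \<cdot> x" "p' \<cdot> f\<^sub>1 = f \<cdot> p" "f\<^sub>1 \<cdot> s = s' \<cdot> f"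
    using f by (simp_all add: is_split_extension_morphism_def)
  have [simp]: "y \<in> Arr C" "Dom C y = Dom C k'" "Cod C y = Dom C k''"
      "g\<^sub>1 \<in> Arr C" "Dom C g\<^sub>1 = Dom C p'" "Cod C g\<^sub>1 = Dom C p''"
      "g \<in> Arr C" "Dom C g = Cod C p'" "Cod C g = Cod C p''"
    and G: "g\<^sub>1 \<cdot> k' = k'' \<cdot> y" "p'' \<cdot> g\<^sub>1 = g \<cdot> p'" "g\<^sub>1 \<cdot> s' = s'' \<cdot> g"
    using g by (simp_all add: is_split_extension_morphism_def)
  show ?thesis
    by (simp add: is_split_extension_morphism_def F Comp_eq_extend[OF G(1)] Comp_eq_extend[OF G(2)]
      Comp_eq_extend[OF G(3)])
qed

lemma classifying_morphism:
  assumes "is_split_extension_classifier C X A k p s" "is_split_extension C X B k' p' s'"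
  obtains \<phi>\<^sub>1 \<phi> where "\<phi> \<in> Hom C B A"
    "is_split_extension_morphism C (k', p', s') (k, p, s) (Ide C X) \<phi>\<^sub>1 \<phi>"
proof -
  have "\<exists>!\<phi>. \<phi> \<in> Hom C B A \<and>
      (\<exists>\<phi>\<^sub>1. is_split_extension_morphism C (k', p', s') (k, p, s) (Ide C X) \<phi>\<^sub>1 \<phi>)"
    using assms unfolding is_split_extension_classifier_def by blast
  then show thesis using that by blast
qed

end

theorem proposition6p2:
  fixes C :: "('o, 'm) cat"
    and G H Q ActG ActH ActQ :: 'o
    and h q kG pG sG kH pH sH kQ pQ sQ :: 'm
  assumes "semi_abelian C"
    and "action_representative C"
    and "h \<in> Hom C H G" and "characteristic C h"
    and "q \<in> Hom C G Q" and "is_cokernel C h q"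
    and "is_split_extension_classifier C G ActG kG pG sG"
    and "is_split_extension_classifier C H ActH kH pH sH"
    and "is_split_extension_classifier C Q ActQ kQ pQ sQ"
  defines "\<zeta>G \<equiv> action_of_split_extension C kG pG sG"
    and "\<zeta>H \<equiv> action_of_split_extension C kH pH sH"
  shows "(\<exists>q' q\<^sub>1. q' \<in> Hom C ActG ActQ \<and> q\<^sub>1 \<in> Hom C (Dom C pG) (Dom C pQ) \<and>
            is_split_extension_morphism C (kG, pG, sG) (kQ, pQ, sQ) q q\<^sub>1 q') \<and>
         (\<exists>h' \<in> Hom C ActG ActH.
            \<zeta>H \<cdot>\<^bsub>C\<^esub> flat_map C h' (Ide C H) = restrict_action C h ActG \<zeta>G)"
proof
  interpret semi_abelian_category C by unfold_locales (rule assms(1))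
  have extG: "is_split_extension C G ActG kG pG sG"
    and extH: "is_split_extension C H ActH kH pH sH"
    and extQ: "is_split_extension C Q ActQ kQ pQ sQ"
    using assms(7-9) unfolding is_split_extension_classifier_def by blast+
  have h: "h \<in> Arr C" "Dom C h = H" "Cod C h = G" and q: "q \<in> Arr C" "Dom C q = G" "Cod C q = Q"
    using assms(3,5) by simp_all
  show "\<exists>q' q\<^sub>1. q' \<in> Hom C ActG ActQ \<and> q\<^sub>1 \<in> Hom C (Dom C pG) (Dom C pQ) \<and>
      is_split_extension_morphism C (kG, pG, sG) (kQ, pQ, sQ) q q\<^sub>1 q'"
  proof -
    obtain k p s e where ext: "is_split_extension C Q ActG k p s"
      and e: "is_split_extension_morphism C (kG, pG, sG) (k, p, s) q e (Ide C ActG)"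
      using characteristic_quotient[OF extG assms(3,4,6)] q by metis
    obtain \<phi>\<^sub>1 \<phi> where \<phi>: "\<phi> \<in> Hom C ActG ActQ"
        "is_split_extension_morphism C (k, p, s) (kQ, pQ, sQ) (Ide C Q) \<phi>\<^sub>1 \<phi>"
      by (rule classifying_morphism[OF assms(9) ext])
    \<comment> \<open>The quotient morphism is the identity on Act(G) and the classifying morphism
      is the identity on Q, so the composite is \<open>q\<close> on kernels and \<phi> on
      actors.\<close>
    have "is_split_extension_morphism C (kG, pG, sG) (kQ, pQ, sQ) (Ide C Q \<cdot>\<^bsub>C\<^esub> q) (\<phi>\<^sub>1 \<cdot>\<^bsub>C\<^esub> e)
        (\<phi> \<cdot>\<^bsub>C\<^esub> Ide C ActG)"
      by (rule split_extension_morphism_compose[OF e \<phi>(2)])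
        (simp_all add: split_extension_arrows[OF extG] split_extension_arrows[OF ext]
          split_extension_arrows[OF extQ])
    then have "is_split_extension_morphism C (kG, pG, sG) (kQ, pQ, sQ) q (\<phi>\<^sub>1 \<cdot>\<^bsub>C\<^esub> e) \<phi>"
      using q \<phi>(1) by (simp add: Ide_right)
    moreover from this have "\<phi>\<^sub>1 \<cdot>\<^bsub>C\<^esub> e \<in> Hom C (Dom C pG) (Dom C pQ)"
      unfolding is_split_extension_morphism_def by simp
    ultimately show ?thesis using \<phi>(1) by blast
  qed
  have "is_restricted_action C h ActG \<zeta>G (restrict_action C h ActG \<zeta>G)"
    by (rule characteristic_restricted[OF assms(4)])
      (simp_all add: split_extension_arrows[OF extG] h \<zeta>G_def action_of_split_extension_is_action[OF extG])
  moreover have "is_mono C h" using assms(4) by (simp add: characteristic_def)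
  \<comment> \<open>The restricted canonical action is induced by a split extension of Act(G) by H,
    to which the universal property of the classifier of H applies.\<close>
  ultimately obtain n p s where ext: "is_split_extension C H ActG n p s"
    and act: "action_of_split_extension C n p s = restrict_action C h ActG \<zeta>G"
    using restricted_split_extension[OF extG assms(3)] unfolding \<zeta>G_def by metis
  obtain \<phi>\<^sub>1 \<phi> where \<phi>: "\<phi> \<in> Hom C ActG ActH"
      "is_split_extension_morphism C (n, p, s) (kH, pH, sH) (Ide C H) \<phi>\<^sub>1 \<phi>"
    by (rule classifying_morphism[OF assms(8) ext])
  have "\<zeta>H \<cdot>\<^bsub>C\<^esub> flat_map C \<phi> (Ide C H) = restrict_action C h ActG \<zeta>G"
    using action_of_split_extension_natural[OF extH ext \<phi>(2)] act by (simp add: \<zeta>H_def)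
  with \<phi>(1) show "\<exists>h' \<in> Hom C ActG ActH.
      \<zeta>H \<cdot>\<^bsub>C\<^esub> flat_map C h' (Ide C H) = restrict_action C h ActG \<zeta>G"
    by blast
qed

end
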